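(* Let $(M,g)$ be a Riemannian manifold and let $\Psi\in\Omega^{2k}(M)$ ($k\ge1$) be a form of even degree that is parallel with respect to the Levi-Civita connection. Let $\hat\Psi:=\partial_g\Psi\in\Omega^{2k-1}(M,TM)$. Then $\hat\Psi$ is a Maurer–Cartan element, i.e. $[\hat\Psi,\hat\Psi]^{FN}=0$.
   Context: $\Omega^k(M,TM)$ is the space of sections of $\Lambda^kT^*M\otimes TM$. The contraction $\partial_g:\Omega^k(M)\to\Omega^{k-1}(M,TM)$ is $\partial_g\alpha=\sum_i(\imath_{e_i}\alpha)\otimes(e^i)^\#$ for a local frame $(e_i)$ with dual coframe $(e^i)$, where $\#:T^*M\to TM$ is the metric isomorphism. The Frölicher–Nijenhuis bracket $[\cdot,\cdot]^{FN}:\Omega^k(M,TM)\times\Omega^l(M,TM)\to\Omega^{k+l}(M,TM)$ is the $\mathbb R$-bilinear bracket determined by $[\alpha\otimes X,\beta\otimes Y]^{FN}=\alpha\wedge\beta\otimes[X,Y]+\alpha\wedge\mathcal L_X\beta\otimes Y-\mathcal L_Y\alpha\wedge\beta\otimes X+(-1)^k\big(d\alpha\wedge(\imath_X\beta)\otimes Y+(\imath_Y\alpha)\wedge d\beta\otimes X\big)$ for $\alpha\in\Omega^k(M)$, $\beta\in\Omega^l(M)$ and vector fields $X,Y$. *)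

theory Defs
  imports "HOL-Analysis.Analysis" "HOL-Combinatorics.Permutations"
begin

section \<open>Smooth maps and smooth atlases\<close>

primrec Ck_on :: "nat \<Rightarrow> 'a::real_normed_vector set \<Rightarrow> ('a \<Rightarrow> 'b::real_normed_vector) \<Rightarrow> bool" where
  "Ck_on 0 S f \<longleftrightarrow> continuous_on S f"
| "Ck_on (Suc n) S f \<longleftrightarrow>
     f differentiable_on S \<and> (\<forall>v. Ck_on n S (\<lambda>x. frechet_derivative f (at x) v))"

text \<open>Only used for open sets \<open>S\<close>.\<close>

definition smooth_on :: "'a::real_normed_vector set \<Rightarrow> ('a \<Rightarrow> 'b::real_normed_vector) \<Rightarrow> bool" where
  "smooth_on S f \<longleftrightarrow> (\<forall>n. Ck_on n S f)"

text \<open>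
  A chart is a pair of an open subset of the manifold (the whole type \<open>'a\<close>) and a coordinate map,
  whose values off this subset are irrelevant.
\<close>

type_synonym ('a, 'e) chart = "'a set \<times> ('a \<Rightarrow> 'e)"

definition chart_image :: "('a, 'e) chart \<Rightarrow> 'e set" where
  "chart_image c = snd c ` fst c"

definition is_chart :: "('a::topological_space, 'e::euclidean_space) chart \<Rightarrow> bool" where
  "is_chart c \<longleftrightarrow> open (fst c) \<and> open (chart_image c) \<and>
     (\<exists>\<psi>. homeomorphism (fst c) (chart_image c) (snd c) \<psi>)"

definition overlap :: "('a, 'e) chart \<Rightarrow> ('a, 'e) chart \<Rightarrow> 'e set" where
  "overlap c d = snd c ` (fst c \<inter> fst d)"

definition transition :: "('a, 'e) chart \<Rightarrow> ('a, 'e) chart \<Rightarrow> 'e \<Rightarrow> 'e" where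
  "transition c d = snd d \<circ> inv_into (fst c) (snd c)"

definition smooth_atlas :: "('a::topological_space, 'e::euclidean_space) chart set \<Rightarrow> bool" where
  "smooth_atlas A \<longleftrightarrow> (\<forall>c\<in>A. is_chart c) \<and> (\<Union>c\<in>A. fst c) = UNIV \<and>
     (\<forall>c\<in>A. \<forall>d\<in>A. smooth_on (overlap c d) (transition c d))"

text \<open>
  The tangent space at the point with coordinates \<open>x\<close> in the chart \<open>c\<close> is identified with the
  model space by means of the coordinate frame; \<open>dtransition c d x\<close> is the resulting change of
  identification from \<open>c\<close> to \<open>d\<close>.
\<close>

definition dtransition :: "('a, 'e::euclidean_space) chart \<Rightarrow> ('a, 'e) chart \<Rightarrow> 'e \<Rightarrow> 'e \<Rightarrow> 'e" where
  "dtransition c d x = frechet_derivative (transition c d) (at x)"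


section \<open>Differential forms\<close>

text \<open>
  An alternating \<open>k\<close>-linear map takes its arguments in the positions \<open>0, \<dots>, k - 1\<close> of a sequence
  and ignores the other positions.
\<close>

definition alternating_map :: "nat \<Rightarrow> ((nat \<Rightarrow> 'e::real_vector) \<Rightarrow> 'b::real_vector) \<Rightarrow> bool" where
  "alternating_map k a \<longleftrightarrow>
     (\<forall>v w. (\<forall>i<k. v i = w i) \<longrightarrow> a v = a w) \<and>
     (\<forall>v. \<forall>i<k. linear (\<lambda>u. a (v(i := u)))) \<and>
     (\<forall>v. \<forall>i<k. \<forall>j<k. i \<noteq> j \<and> v i = v j \<longrightarrow> a v = 0)"

text \<open>
  Smooth \<open>k\<close>-forms on an open subset \<open>S\<close> of the model space, real valued for \<open>'b = real\<close>
  and with values in the tangent bundle for \<open>'b = 'e\<close>.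
\<close>

definition form_on :: "'e set \<Rightarrow> nat \<Rightarrow>
    ('e \<Rightarrow> (nat \<Rightarrow> 'e::euclidean_space) \<Rightarrow> 'b::real_normed_vector) \<Rightarrow> bool" where
  "form_on S k \<alpha> \<longleftrightarrow> (\<forall>x\<in>S. alternating_map k (\<alpha> x)) \<and> (\<forall>v. smooth_on S (\<lambda>x. \<alpha> x v))"

text \<open>
  Tensor fields on the manifold are given by their local expressions in the charts of an atlas,
  subject to the transformation law: \<open>\<Omega>\<^sup>k(M)\<close> and \<open>\<Omega>\<^sup>k(M,TM)\<close>.
\<close>

definition forms :: "('a, 'e::euclidean_space) chart set \<Rightarrow> nat \<Rightarrow>
    (('a, 'e) chart \<Rightarrow> 'e \<Rightarrow> (nat \<Rightarrow> 'e) \<Rightarrow> real) set" where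
  "forms A k = {\<alpha>. (\<forall>c\<in>A. form_on (chart_image c) k (\<alpha> c)) \<and>
     (\<forall>c\<in>A. \<forall>d\<in>A. \<forall>x\<in>overlap c d. \<forall>v.
        \<alpha> d (transition c d x) (\<lambda>i. dtransition c d x (v i)) = \<alpha> c x v)}"

definition tangent_forms :: "('a, 'e::euclidean_space) chart set \<Rightarrow> nat \<Rightarrow>
    (('a, 'e) chart \<Rightarrow> 'e \<Rightarrow> (nat \<Rightarrow> 'e) \<Rightarrow> 'e) set" where
  "tangent_forms A k = {K. (\<forall>c\<in>A. form_on (chart_image c) k (K c)) \<and>
     (\<forall>c\<in>A. \<forall>d\<in>A. \<forall>x\<in>overlap c d. \<forall>v.
        K d (transition c d x) (\<lambda>i. dtransition c d x (v i)) = dtransition c d x (K c x v))}"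


section \<open>Calculus of forms in a chart\<close>

definition wedge :: "nat \<Rightarrow> nat \<Rightarrow> ((nat \<Rightarrow> 'e) \<Rightarrow> real) \<Rightarrow> ((nat \<Rightarrow> 'e) \<Rightarrow> real) \<Rightarrow> (nat \<Rightarrow> 'e) \<Rightarrow> real" where
  "wedge k l a b v = 1 / (fact k * fact l) *
     (\<Sum>\<pi> | \<pi> permutes {..<k + l}. real_of_int (sign \<pi>) * a (\<lambda>i. v (\<pi> i)) * b (\<lambda>i. v (\<pi> (k + i))))"

definition interior_product :: "nat \<Rightarrow> 'e \<Rightarrow> ((nat \<Rightarrow> 'e) \<Rightarrow> real) \<Rightarrow> (nat \<Rightarrow> 'e) \<Rightarrow> real" where
  "interior_product k x a v = (if k = 0 then 0 else a (case_nat x v))"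

definition exterior_derivative :: "nat \<Rightarrow> ('e \<Rightarrow> (nat \<Rightarrow> 'e::euclidean_space) \<Rightarrow> real) \<Rightarrow>
    'e \<Rightarrow> (nat \<Rightarrow> 'e) \<Rightarrow> real" where
  "exterior_derivative k \<alpha> x v =
     (\<Sum>i\<le>k. (-1) ^ i * frechet_derivative (\<lambda>y. \<alpha> y (\<lambda>j. v (if j < i then j else Suc j))) (at x) (v i))"

definition lie_bracket :: "('e \<Rightarrow> 'e::euclidean_space) \<Rightarrow> ('e \<Rightarrow> 'e) \<Rightarrow> 'e \<Rightarrow> 'e" where
  "lie_bracket X Y x = frechet_derivative Y (at x) (X x) - frechet_derivative X (at x) (Y x)"

text \<open>
  This is \<open>(\<L>\<^sub>X\<beta>)(v\<^sub>0,\<dots>) = X(\<beta>(v\<^sub>0,\<dots>)) - \<Sum>\<^sub>i \<beta>(\<dots>,[X,v\<^sub>i],\<dots>)\<close> for constant vector fields \<open>v\<^sub>i\<close>,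
  for which \<open>[X,v\<^sub>i]\<close> is minus the derivative of \<open>X\<close> in the direction \<open>v\<^sub>i\<close>.
\<close>

definition lie_derivative :: "nat \<Rightarrow> ('e \<Rightarrow> 'e) \<Rightarrow> ('e \<Rightarrow> (nat \<Rightarrow> 'e::euclidean_space) \<Rightarrow> real) \<Rightarrow>
    'e \<Rightarrow> (nat \<Rightarrow> 'e) \<Rightarrow> real" where
  "lie_derivative k X \<beta> x v =
     frechet_derivative (\<lambda>y. \<beta> y v) (at x) (X x) +
     (\<Sum>i<k. \<beta> x (v(i := frechet_derivative X (at x) (v i))))"


section \<open>The Froelicher--Nijenhuis bracket\<close>

definition tensor :: "('e \<Rightarrow> (nat \<Rightarrow> 'e) \<Rightarrow> real) \<Rightarrow> ('e \<Rightarrow> 'e::euclidean_space) \<Rightarrow>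
    'e \<Rightarrow> (nat \<Rightarrow> 'e) \<Rightarrow> 'e" where
  "tensor \<alpha> X x v = \<alpha> x v *\<^sub>R X x"

text \<open>\<open>[\<alpha> \<otimes> X, \<beta> \<otimes> Y]\<close> for a \<open>k\<close>-form \<open>\<alpha>\<close> and an \<open>l\<close>-form \<open>\<beta>\<close>.\<close>

definition fn_decomposable :: "nat \<Rightarrow> nat \<Rightarrow>
    ('e \<Rightarrow> (nat \<Rightarrow> 'e) \<Rightarrow> real) \<Rightarrow> ('e \<Rightarrow> 'e::euclidean_space) \<Rightarrow>
    ('e \<Rightarrow> (nat \<Rightarrow> 'e) \<Rightarrow> real) \<Rightarrow> ('e \<Rightarrow> 'e) \<Rightarrow> 'e \<Rightarrow> (nat \<Rightarrow> 'e) \<Rightarrow> 'e" where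
  "fn_decomposable k l \<alpha> X \<beta> Y x v =
     wedge k l (\<alpha> x) (\<beta> x) v *\<^sub>R lie_bracket X Y x
   + wedge k l (\<alpha> x) (lie_derivative l X \<beta> x) v *\<^sub>R Y x
   - wedge k l (lie_derivative k Y \<alpha> x) (\<beta> x) v *\<^sub>R X x
   + (-1) ^ k *\<^sub>R
      (wedge (k + 1) (l - 1) (exterior_derivative k \<alpha> x) (interior_product l (X x) (\<beta> x)) v *\<^sub>R Y x
     + wedge (k - 1) (l + 1) (interior_product k (Y x) (\<alpha> x)) (exterior_derivative l \<beta> x) v *\<^sub>R X x)"

text \<open>
  In a chart \<open>K = \<Sum>\<^sub>b K\<^sup>b \<otimes> \<partial>\<^sub>b\<close> with respect to the coordinate frame, and the bracket is the
  bilinear extension of the formula above.  The theorems \<open>fn_bracket_bilinear\<close> and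
  \<open>fn_bracket_tensor\<close> below show that it is bilinear and that it satisfies the formula for arbitrary
  decomposable arguments; it is the only operation with these properties.
\<close>

definition fn_bracket :: "nat \<Rightarrow> nat \<Rightarrow> ('e \<Rightarrow> (nat \<Rightarrow> 'e::euclidean_space) \<Rightarrow> 'e) \<Rightarrow>
    ('e \<Rightarrow> (nat \<Rightarrow> 'e) \<Rightarrow> 'e) \<Rightarrow> 'e \<Rightarrow> (nat \<Rightarrow> 'e) \<Rightarrow> 'e" where
  "fn_bracket k l K L x v =
     (\<Sum>b\<in>Basis. \<Sum>c\<in>Basis.
        fn_decomposable k l (\<lambda>y w. K y w \<bullet> b) (\<lambda>_. b) (\<lambda>y w. L y w \<bullet> c) (\<lambda>_. c) x v)"


section \<open>Riemannian metrics and the Levi-Civita connection\<close>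

definition riemannian_metric :: "('a, 'e::euclidean_space) chart set \<Rightarrow>
    (('a, 'e) chart \<Rightarrow> 'e \<Rightarrow> 'e \<Rightarrow> 'e \<Rightarrow> real) \<Rightarrow> bool" where
  "riemannian_metric A g \<longleftrightarrow>
     (\<forall>c\<in>A. (\<forall>x\<in>chart_image c. bilinear (g c x) \<and> (\<forall>u v. g c x u v = g c x v u) \<and>
                (\<forall>u. u \<noteq> 0 \<longrightarrow> g c x u u > 0)) \<and>
            (\<forall>u v. smooth_on (chart_image c) (\<lambda>x. g c x u v))) \<and>
     (\<forall>c\<in>A. \<forall>d\<in>A. \<forall>x\<in>overlap c d. \<forall>u v.
        g d (transition c d x) (dtransition c d x u) (dtransition c d x v) = g c x u v)"

text \<open>
  A connection is given by its Christoffel symbols \<open>\<Gamma> c x u v = \<nabla>\<^sub>u v - \<partial>\<^sub>u v\<close>; the transformation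
  law, which involves the second derivative of the transition map, makes the covariant derivatives
  computed in different charts agree.
\<close>

definition covariant_derivative :: "('e \<Rightarrow> 'e \<Rightarrow> 'e \<Rightarrow> 'e) \<Rightarrow> ('e \<Rightarrow> 'e::euclidean_space) \<Rightarrow>
    ('e \<Rightarrow> 'e) \<Rightarrow> 'e \<Rightarrow> 'e" where
  "covariant_derivative \<Gamma> X Y x = frechet_derivative Y (at x) (X x) + \<Gamma> x (X x) (Y x)"

definition is_connection :: "('a, 'e::euclidean_space) chart set \<Rightarrow>
    (('a, 'e) chart \<Rightarrow> 'e \<Rightarrow> 'e \<Rightarrow> 'e \<Rightarrow> 'e) \<Rightarrow> bool" where
  "is_connection A \<Gamma> \<longleftrightarrow>
     (\<forall>c\<in>A. (\<forall>x\<in>chart_image c. bilinear (\<Gamma> c x)) \<and>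
            (\<forall>u v. smooth_on (chart_image c) (\<lambda>x. \<Gamma> c x u v))) \<and>
     (\<forall>c\<in>A. \<forall>d\<in>A. \<forall>x\<in>overlap c d. \<forall>u v.
        dtransition c d x (\<Gamma> c x u v) =
          frechet_derivative (\<lambda>y. dtransition c d y v) (at x) u +
          \<Gamma> d (transition c d x) (dtransition c d x u) (dtransition c d x v))"

definition levi_civita_connection :: "('a, 'e::euclidean_space) chart set \<Rightarrow>
    (('a, 'e) chart \<Rightarrow> 'e \<Rightarrow> 'e \<Rightarrow> 'e \<Rightarrow> real) \<Rightarrow>
    (('a, 'e) chart \<Rightarrow> 'e \<Rightarrow> 'e \<Rightarrow> 'e \<Rightarrow> 'e) \<Rightarrow> bool" where
  "levi_civita_connection A g \<Gamma> \<longleftrightarrow> is_connection A \<Gamma> \<and>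
     (\<forall>c\<in>A. \<forall>X Y. smooth_on (chart_image c) X \<and> smooth_on (chart_image c) Y \<longrightarrow>
        (\<forall>x\<in>chart_image c.
           covariant_derivative (\<Gamma> c) X Y x - covariant_derivative (\<Gamma> c) Y X x = lie_bracket X Y x)) \<and>
     (\<forall>c\<in>A. \<forall>X Y Z. smooth_on (chart_image c) X \<and> smooth_on (chart_image c) Y \<and>
           smooth_on (chart_image c) Z \<longrightarrow>
        (\<forall>x\<in>chart_image c.
           frechet_derivative (\<lambda>y. g c y (Y y) (Z y)) (at x) (X x) =
             g c x (covariant_derivative (\<Gamma> c) X Y x) (Z x) +
             g c x (Y x) (covariant_derivative (\<Gamma> c) X Z x)))"

text \<open>
  \<open>(\<nabla>\<^sub>u\<alpha>)(v\<^sub>0,\<dots>) = u(\<alpha>(v\<^sub>0,\<dots>)) - \<Sum>\<^sub>i \<alpha>(\<dots>,\<nabla>\<^sub>u v\<^sub>i,\<dots>)\<close>, evaluated on constant vector fields \<open>v\<^sub>i\<close>.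
\<close>

definition covariant_derivative_form :: "('e \<Rightarrow> 'e \<Rightarrow> 'e \<Rightarrow> 'e) \<Rightarrow> nat \<Rightarrow>
    ('e \<Rightarrow> (nat \<Rightarrow> 'e::euclidean_space) \<Rightarrow> real) \<Rightarrow> 'e \<Rightarrow> 'e \<Rightarrow> (nat \<Rightarrow> 'e) \<Rightarrow> real" where
  "covariant_derivative_form \<Gamma> k \<alpha> x u v =
     frechet_derivative (\<lambda>y. \<alpha> y v) (at x) u - (\<Sum>i<k. \<alpha> x (v(i := \<Gamma> x u (v i))))"

definition parallel_form :: "('a, 'e::euclidean_space) chart set \<Rightarrow>
    (('a, 'e) chart \<Rightarrow> 'e \<Rightarrow> 'e \<Rightarrow> 'e \<Rightarrow> 'e) \<Rightarrow> nat \<Rightarrow>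
    (('a, 'e) chart \<Rightarrow> 'e \<Rightarrow> (nat \<Rightarrow> 'e) \<Rightarrow> real) \<Rightarrow> bool" where
  "parallel_form A \<Gamma> k \<alpha> \<longleftrightarrow>
     (\<forall>c\<in>A. \<forall>x\<in>chart_image c. \<forall>u v. covariant_derivative_form (\<Gamma> c) k (\<alpha> c) x u v = 0)"


section \<open>The contraction with the metric\<close>

definition sharp :: "('e \<Rightarrow> 'e \<Rightarrow> real) \<Rightarrow> ('e \<Rightarrow> real) \<Rightarrow> 'e" where
  "sharp h \<theta> = (THE u. \<forall>w. h u w = \<theta> w)"

text \<open>The frame is the coordinate frame, whose dual coframe consists of the coordinate functionals.\<close>

definition contraction :: "('e \<Rightarrow> 'e \<Rightarrow> 'e \<Rightarrow> real) \<Rightarrow> nat \<Rightarrow>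
    ('e \<Rightarrow> (nat \<Rightarrow> 'e::euclidean_space) \<Rightarrow> real) \<Rightarrow> 'e \<Rightarrow> (nat \<Rightarrow> 'e) \<Rightarrow> 'e" where
  "contraction g k \<alpha> x v =
     (\<Sum>b\<in>Basis. interior_product k b (\<alpha> x) v *\<^sub>R sharp (g x) (\<lambda>w. w \<bullet> b))"

text \<open>
  The equation \<open>[K,K]\<^sup>F\<^sup>N = 0\<close> for \<open>K \<in> \<Omega>\<^sup>m(M,TM)\<close>, expressed in every chart of the atlas.
\<close>

definition maurer_cartan :: "('a, 'e::euclidean_space) chart set \<Rightarrow> nat \<Rightarrow>
    (('a, 'e) chart \<Rightarrow> 'e \<Rightarrow> (nat \<Rightarrow> 'e) \<Rightarrow> 'e) \<Rightarrow> bool" where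
  "maurer_cartan A m K \<longleftrightarrow> K \<in> tangent_forms A m \<and>
     (\<forall>c\<in>A. \<forall>x\<in>chart_image c. \<forall>v. fn_bracket m m (K c) (K c) x v = 0)"


section \<open>The characterisation of the Froelicher--Nijenhuis bracket\<close>

lemma alternating_mapD:
  assumes "alternating_map k a"
  shows "(\<And>i. i < k \<Longrightarrow> v i = w i) \<Longrightarrow> a v = a w"
    and "i < k \<Longrightarrow> linear (\<lambda>u. a (v(i := u)))"
    and "i < k \<Longrightarrow> j < k \<Longrightarrow> i \<noteq> j \<Longrightarrow> v i = v j \<Longrightarrow> a v = 0"
proof -
  show "(\<And>i. i < k \<Longrightarrow> v i = w i) \<Longrightarrow> a v = a w"
    using assms unfolding alternating_map_def by simp
  show "i < k \<Longrightarrow> linear (\<lambda>u. a (v(i := u)))"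
    using assms unfolding alternating_map_def by simp
  show "i < k \<Longrightarrow> j < k \<Longrightarrow> i \<noteq> j \<Longrightarrow> v i = v j \<Longrightarrow> a v = 0"
    using assms unfolding alternating_map_def by simp
qed

lemma alternating_map_transpose:
  assumes a: "alternating_map k a" and ij: "i < k" "j < k" "i \<noteq> j"
  shows "a (\<lambda>n. v (Transposition.transpose i j n)) = - a v"
proof -
  define f where "f u w = a (v(i := u, j := w))" for u w
  have 0: "f u u = 0" for u
    unfolding f_def using ij by (intro alternating_mapD(3)[OF a, of i j]) auto
  have lin2: "linear (f u)" for u
    unfolding f_def using alternating_mapD(2)[OF a ij(2), of "v(i := u)"] by simp
  have lin1: "linear (\<lambda>u. f u w)" for w
    unfolding f_def using alternating_mapD(2)[OF a ij(1), of "v(j := w)"] ij(3)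
    by (simp add: fun_upd_twist)
  have "f (v i + v j) (v i + v j) = f (v i) (v i) + f (v i) (v j) + (f (v j) (v i) + f (v j) (v j))"
    by (simp add: linear_add[OF lin1] linear_add[OF lin2] algebra_simps)
  then have "f (v j) (v i) = - f (v i) (v j)"
    by (simp add: 0 add_eq_0_iff2)
  moreover have "v(i := v j, j := v i) = (\<lambda>n. v (Transposition.transpose i j n))"
    using ij by (auto simp: fun_eq_iff transpose_def)
  ultimately show ?thesis unfolding f_def by simp
qed

lemma alternating_map_permutes:
  fixes a :: "(nat \<Rightarrow> 'e::real_vector) \<Rightarrow> 'b::real_vector"
  assumes a: "alternating_map k a" and p: "p permutes {..<k}"
  shows "a (\<lambda>n. v (p n)) = real_of_int (sign p) *\<^sub>R a v"
proof -
  have "finite {..<k}" by simp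
  with p show ?thesis
  proof (induction arbitrary: v rule: permutes_induct)
    case id
    then show ?case by (simp add: sign_id)
  next
    case (swap i j p)
    have perm: "permutation p" using swap by (meson finite_lessThan permutation_permutes)
    have "a (\<lambda>n. v ((Transposition.transpose i j \<circ> p) n)) = real_of_int (sign p) *\<^sub>R a (\<lambda>n. v (Transposition.transpose i j n))"
      using swap.IH[of "\<lambda>n. v (Transposition.transpose i j n)"] by simp
    also have "\<dots> = real_of_int (sign (Transposition.transpose i j \<circ> p)) *\<^sub>R a v"
      using swap perm by (simp add: alternating_map_transpose[OF a] sign_compose permutation_swap_id sign_swap_id)
    finally show ?case by (simp add: comp_def)
  qed
qed

text \<open>\<open>cyc k\<close> is the cycle \<open>0 \<mapsto> k\<close>, \<open>i + 1 \<mapsto> i\<close> for \<open>i < k\<close>.\<close>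

primrec cyc :: "nat \<Rightarrow> nat \<Rightarrow> nat" where
  "cyc 0 = id"
| "cyc (Suc k) = Transposition.transpose k (Suc k) \<circ> cyc k"

lemma cyc_apply: "cyc k n = (if n = 0 then k else if n \<le> k then n - 1 else n)"
proof (induction k)
  case (Suc k)
  then show ?case by (cases "n = Suc k") (auto simp: Transposition.transpose_def)
qed simp

lemma cyc_permutes: "k < n \<Longrightarrow> cyc k permutes {..<n}"
  by (induction k) (auto intro!: permutes_compose permutes_swap_id)

lemma sign_cyc: "sign (cyc k) = (-1) ^ k"
proof (induction k)
  case (Suc k)
  have "permutation (cyc k)" using cyc_permutes[of k "Suc k"] permutation_permutes by blast
  then have "sign (cyc (Suc k)) = sign (Transposition.transpose k (Suc k)) * sign (cyc k)"
    unfolding cyc.simps by (intro sign_compose permutation_swap_id)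
  then show ?case using Suc by (simp add: sign_swap_id comp_def)
qed simp

lemma wedge_one_left:
  fixes t :: "'e::real_vector \<Rightarrow> real"
  assumes a: "alternating_map k a"
  shows "wedge 1 k (\<lambda>w. t (w 0)) a v =
    (\<Sum>i\<le>k. (-1) ^ i * t (v i) * a (\<lambda>j. v (if j < i then j else Suc j)))"
proof -
  let ?f = "\<lambda>\<pi>. real_of_int (sign \<pi>) * t (v (\<pi> 0)) * a (\<lambda>i. v (\<pi> (1 + i)))"
  have set: "{..<1 + k} = insert 0 {1..k}" by auto
  have main: "(\<Sum>q | q permutes {1..k}. ?f (Transposition.transpose 0 b \<circ> q)) =
      fact k * ((-1) ^ b * t (v b) * a (\<lambda>j. v (if j < b then j else Suc j)))"
    if b: "b \<in> insert 0 {1..k}" for b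
  proof -
    have "?f (Transposition.transpose 0 b \<circ> q) = (-1) ^ b * t (v b) * a (\<lambda>j. v (if j < b then j else Suc j))"
      if q: "q permutes {1..k}" for q
    proof -
      have permq: "permutation q" using q permutation_permutes by blast
      have q0: "q 0 = 0" using q by (auto simp: permutes_def)
      define p where "p = (\<lambda>i. if i < k then q (Suc i) - 1 else i)"
      have bij: "bij_betw (\<lambda>x. x - 1) {1..k} {..<k}"
        by (rule bij_betw_byWitness[of _ Suc]) auto
      have pm: "map_permutation {1..k} (\<lambda>x. x - 1) q = p"
      proof
        fix i
        show "map_permutation {1..k} (\<lambda>x. x - 1) q i = p i"
        proof (cases "i < k")
          case True
          have "inv_into {1..k} (\<lambda>x. x - 1) i = Suc i"
            using True by (intro inv_into_f_eq) (auto simp: inj_on_def)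
          moreover have "i \<in> (\<lambda>x. x - 1) ` {1..k}" using True by (force intro: image_eqI[of _ _ "Suc i"])
          ultimately show ?thesis using True by (simp add: map_permutation_def restrict_id_def p_def)
        next
          case False
          then show ?thesis by (auto simp: map_permutation_def restrict_id_def p_def)
        qed
      qed
      have pp: "p permutes {..<k}"
        using map_permutation_permutes[OF bij q] unfolding pm .
      have sp: "sign p = sign q"
        using sign_map_permutation[OF bij_betw_imp_inj_on[OF bij] q] unfolding pm by simp
      have sq: "q (Suc i) = Suc (p i)" if "i < k" for i
      proof -
        have "q (Suc i) \<in> {1..k}" using permutes_in_image[OF q, of "Suc i"] that by simp
        then show ?thesis using that by (simp add: p_def)
      qed
      define w where "w = (\<lambda>i. v (Transposition.transpose 0 b (Suc i)))"
      have "a (\<lambda>i. v ((Transposition.transpose 0 b \<circ> q) (1 + i))) = a (\<lambda>i. w (p i))"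
        by (rule alternating_mapD(1)[OF a]) (simp add: w_def sq)
      also have "\<dots> = real_of_int (sign q) * a w"
        using alternating_map_permutes[OF a pp, of w] by (simp add: sp)
      finally have 1: "a (\<lambda>i. v ((Transposition.transpose 0 b \<circ> q) (1 + i))) = real_of_int (sign q) * a w" .
      have 2: "real_of_int (sign (Transposition.transpose 0 b)) * a w = (-1) ^ b * a (\<lambda>j. v (if j < b then j else Suc j))"
      proof (cases b)
        case 0
        then show ?thesis by (simp add: w_def sign_swap_id)
      next
        case (Suc b')
        have c: "cyc b' permutes {..<k}" using b Suc by (intro cyc_permutes) auto
        have "(\<lambda>j. v (if j < b then j else Suc j)) = (\<lambda>j. w (cyc b' j))"
        proof
          fix j
          have "(if j < b then j else Suc j) = Transposition.transpose 0 b (Suc (cyc b' j))"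
            using Suc by (auto simp: cyc_apply transpose_def)
          then show "v (if j < b then j else Suc j) = w (cyc b' j)" by (simp add: w_def)
        qed
        then have "a (\<lambda>j. v (if j < b then j else Suc j)) = (-1) ^ b' * a w"
          using alternating_map_permutes[OF a c, of w] by (simp add: sign_cyc)
        then show ?thesis using Suc by (simp add: sign_swap_id)
      qed
      have "sign (Transposition.transpose 0 b \<circ> q) = sign (Transposition.transpose 0 b) * sign q"
        by (simp add: sign_compose permutation_swap_id permq)
      moreover have "real_of_int (sign q) * real_of_int (sign q) = 1"
        by (metis of_int_1 of_int_mult sign_idempotent)
      ultimately have "?f (Transposition.transpose 0 b \<circ> q) = real_of_int (sign (Transposition.transpose 0 b)) * a w * t (v b)"
        unfolding 1 by (simp add: q0)
      then show ?thesis by (simp add: 2)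
    qed
    then have "(\<Sum>q | q permutes {1..k}. ?f (Transposition.transpose 0 b \<circ> q)) =
       (\<Sum>q | q permutes {1..k}. (-1) ^ b * t (v b) * a (\<lambda>j. v (if j < b then j else Suc j)))"
      by (intro sum.cong) auto
    also have "\<dots> = fact k * ((-1) ^ b * t (v b) * a (\<lambda>j. v (if j < b then j else Suc j)))"
      using card_permutations[of "{1..k}" k] by simp
    finally show ?thesis .
  qed
  have "(\<Sum>\<pi> | \<pi> permutes {..<1 + k}. ?f \<pi>) =
      (\<Sum>b\<in>insert 0 {1..k}. \<Sum>q | q permutes {1..k}. ?f (Transposition.transpose 0 b \<circ> q))"
    unfolding set by (rule sum_over_permutations_insert) auto
  also have "\<dots> = (\<Sum>b\<in>insert 0 {1..k}. fact k * ((-1) ^ b * t (v b) * a (\<lambda>j. v (if j < b then j else Suc j))))"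
    using main by (intro sum.cong refl)
  also have "insert 0 {1..k} = {..k}" by auto
  finally show ?thesis
    unfolding wedge_def by (simp add: sum_distrib_left[symmetric] sum_divide_distrib[symmetric])
qed

lemma fact_cancel:
  "c \<noteq> 0 \<Longrightarrow> 1 / (c * d) * (1 / e) * (c * s) = 1 / (e * d) * (s :: real)"
  "c \<noteq> 0 \<Longrightarrow> 1 / (d * c) * (1 / e) * (c * s) = 1 / (d * e) * (s :: real)"
  by simp_all

lemma wedge_one_assoc_left:
  "wedge (1 + k) l (wedge 1 k \<theta> a) b v = 1 / (fact k * fact l) *
     (\<Sum>\<pi> | \<pi> permutes {..<1 + k + l}. real_of_int (sign \<pi>) * \<theta> (\<lambda>i. v (\<pi> i)) *
         a (\<lambda>i. v (\<pi> (1 + i))) * b (\<lambda>i. v (\<pi> (1 + k + i))))"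
proof -
  let ?P = "{\<pi>. \<pi> permutes {..<1 + k + l}}" and ?Q = "{\<sigma>. \<sigma> permutes {..<1 + k}}"
  let ?g = "\<lambda>\<pi>. real_of_int (sign \<pi>) * \<theta> (\<lambda>i. v (\<pi> i)) * a (\<lambda>i. v (\<pi> (1 + i))) * b (\<lambda>i. v (\<pi> (1 + k + i)))"
  have perm: "permutation \<pi>" if "\<pi> \<in> ?P" for \<pi> using that permutation_permutes by blast
  have inner: "(\<Sum>\<pi>\<in>?P. real_of_int (sign \<pi>) * (real_of_int (sign \<sigma>) * \<theta> (\<lambda>i. v (\<pi> (\<sigma> i))) * a (\<lambda>i. v (\<pi> (\<sigma> (1 + i)))))
      * b (\<lambda>i. v (\<pi> (1 + k + i)))) = sum ?g ?P" (is "?l \<sigma> = _") if s: "\<sigma> \<in> ?Q" for \<sigma>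
  proof -
    have sP: "\<sigma> permutes {..<1 + k + l}" using s by (auto intro: permutes_subset)
    then have ps: "permutation \<sigma>" using permutation_permutes by blast
    have fix_s: "\<sigma> (1 + k + i) = 1 + k + i" for i using s by (auto simp: permutes_def)
    have "sum ?g ?P = (\<Sum>\<pi>\<in>?P. ?g (\<pi> \<circ> \<sigma>))" by (rule sum_permutations_compose_right[OF sP])
    also have "\<dots> = ?l \<sigma>"
    proof (rule sum.cong[OF refl])
      fix \<pi> assume "\<pi> \<in> ?P"
      then show "?g (\<pi> \<circ> \<sigma>) = real_of_int (sign \<pi>) * (real_of_int (sign \<sigma>) * \<theta> (\<lambda>i. v (\<pi> (\<sigma> i))) * a (\<lambda>i. v (\<pi> (\<sigma> (1 + i)))))
      * b (\<lambda>i. v (\<pi> (1 + k + i)))"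
        using fix_s by (simp add: sign_compose perm ps)
    qed
    finally show ?thesis by simp
  qed
  have "wedge (1 + k) l (wedge 1 k \<theta> a) b v = 1 / (fact (1 + k) * fact l) * (1 / fact k) *
      (\<Sum>\<pi>\<in>?P. \<Sum>\<sigma>\<in>?Q. real_of_int (sign \<pi>) * (real_of_int (sign \<sigma>) * \<theta> (\<lambda>i. v (\<pi> (\<sigma> i))) * a (\<lambda>i. v (\<pi> (\<sigma> (1 + i)))))
      * b (\<lambda>i. v (\<pi> (1 + k + i))))"
    unfolding wedge_def sum_distrib_left sum_distrib_right by (simp add: mult_ac)
  also have "\<dots> = 1 / (fact (1 + k) * fact l) * (1 / fact k) * (\<Sum>\<sigma>\<in>?Q. ?l \<sigma>)"
    by (subst sum.swap) simp
  also have "(\<Sum>\<sigma>\<in>?Q. ?l \<sigma>) = (\<Sum>\<sigma>\<in>?Q. sum ?g ?P)"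
    by (rule sum.cong[OF refl], rule inner)
  also have "\<dots> = fact (1 + k) * sum ?g ?P"
    using card_permutations[of "{..<Suc k}" "Suc k"] by (simp del: fact_Suc)
  finally show ?thesis by (simp only: fact_cancel[OF fact_nonzero])
qed

lemma wedge_one_assoc_right:
  assumes a: "\<And>v w. (\<And>i. i < k \<Longrightarrow> v i = w i) \<Longrightarrow> a v = a w"
  shows "wedge k (1 + l) a (wedge 1 l \<theta> b) v = 1 / (fact k * fact l) *
     (\<Sum>\<pi> | \<pi> permutes {..<1 + k + l}. real_of_int (sign \<pi>) * a (\<lambda>i. v (\<pi> i)) *
         \<theta> (\<lambda>i. v (\<pi> (k + i))) * b (\<lambda>i. v (\<pi> (k + (1 + i)))))"
proof -
  let ?P = "{\<pi>. \<pi> permutes {..<1 + k + l}}" and ?Q = "{\<sigma>. \<sigma> permutes {..<1 + l}}"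
  let ?g = "\<lambda>\<pi>. real_of_int (sign \<pi>) * a (\<lambda>i. v (\<pi> i)) * \<theta> (\<lambda>i. v (\<pi> (k + i))) * b (\<lambda>i. v (\<pi> (k + (1 + i))))"
  have perm: "permutation \<pi>" if "\<pi> \<in> ?P" for \<pi> using that permutation_permutes by blast
  have inner: "(\<Sum>\<pi>\<in>?P. real_of_int (sign \<pi>) * a (\<lambda>i. v (\<pi> i)) * (real_of_int (sign \<sigma>) * \<theta> (\<lambda>i. v (\<pi> (k + \<sigma> i))) * b (\<lambda>i. v (\<pi> (k + \<sigma> (1 + i))))))
       = sum ?g ?P" (is "?l \<sigma> = _") if s: "\<sigma> \<in> ?Q" for \<sigma>
  proof -
    define \<tau> where "\<tau> = map_permutation {..<1 + l} ((+) k) \<sigma>"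
    have inj: "inj_on ((+) k) {..<1 + l}" by (simp add: inj_on_def)
    have sq: "\<sigma> permutes {..<1 + l}" using s by simp
    have tP: "\<tau> permutes {k..<k + (1 + l)}"
    proof -
      have "(+) k ` {..<1 + l} = {k..<k + (1 + l)}"
        using image_add_atLeastLessThan[of k 0 "1 + l"] by (simp add: atLeast0LessThan add_ac)
      then show ?thesis unfolding \<tau>_def using inj
        by (intro map_permutation_permutes[OF _ sq]) (simp add: bij_betw_def)
    qed
    then have tP': "\<tau> permutes {..<1 + k + l}" by (rule permutes_subset) auto
    then have pt: "permutation \<tau>" using permutation_permutes by blast
    have st: "sign \<tau> = sign \<sigma>" unfolding \<tau>_def by (rule sign_map_permutation[OF inj sq]) simp
    have t1: "\<tau> i = i" if "i < k" for i using tP that by (auto simp: permutes_def)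
    have t2: "\<tau> (k + i) = k + \<sigma> i" for i
    proof (cases "i < 1 + l")
      case True
      then show ?thesis unfolding \<tau>_def using map_permutation_apply[OF inj] by simp
    next
      case False
      then have "\<sigma> i = i" "\<tau> (k + i) = k + i" using sq tP by (auto simp: permutes_def)
      then show ?thesis by simp
    qed
    have "sum ?g ?P = (\<Sum>\<pi>\<in>?P. ?g (\<pi> \<circ> \<tau>))" by (rule sum_permutations_compose_right[OF tP'])
    also have "\<dots> = ?l \<sigma>"
    proof (rule sum.cong[OF refl])
      fix \<pi> assume p: "\<pi> \<in> ?P"
      have "a (\<lambda>i. v ((\<pi> \<circ> \<tau>) i)) = a (\<lambda>i. v (\<pi> i))" by (rule a) (simp add: t1)
      then show "?g (\<pi> \<circ> \<tau>) = real_of_int (sign \<pi>) * a (\<lambda>i. v (\<pi> i)) * (real_of_int (sign \<sigma>) * \<theta> (\<lambda>i. v (\<pi> (k + \<sigma> i))) * b (\<lambda>i. v (\<pi> (k + \<sigma> (1 + i)))))"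
        using p by (simp only: o_apply t2 sign_compose[OF perm[OF p] pt] st of_int_mult mult_ac)
    qed
    finally show ?thesis by simp
  qed
  have set: "{..<k + (1 + l)} = {..<1 + k + l}" by auto
  have "wedge k (1 + l) a (wedge 1 l \<theta> b) v = 1 / (fact k * fact (1 + l)) * (1 / fact l) *
      (\<Sum>\<pi>\<in>?P. \<Sum>\<sigma>\<in>?Q. real_of_int (sign \<pi>) * a (\<lambda>i. v (\<pi> i)) * (real_of_int (sign \<sigma>) * \<theta> (\<lambda>i. v (\<pi> (k + \<sigma> i))) * b (\<lambda>i. v (\<pi> (k + \<sigma> (1 + i))))))"
    unfolding wedge_def set sum_distrib_left sum_distrib_right by (simp add: mult_ac)
  also have "\<dots> = 1 / (fact k * fact (1 + l)) * (1 / fact l) * (\<Sum>\<sigma>\<in>?Q. ?l \<sigma>)"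
    by (subst sum.swap) simp
  also have "(\<Sum>\<sigma>\<in>?Q. ?l \<sigma>) = (\<Sum>\<sigma>\<in>?Q. sum ?g ?P)"
    by (rule sum.cong[OF refl], rule inner)
  also have "\<dots> = fact (1 + l) * sum ?g ?P"
    using card_permutations[of "{..<Suc l}" "Suc l"] by (simp del: fact_Suc)
  finally show ?thesis by (simp only: fact_cancel[OF fact_nonzero])
qed

lemma wedge_one_assoc:
  fixes a b :: "(nat \<Rightarrow> 'e::real_vector) \<Rightarrow> real"
  assumes a: "\<And>v w. (\<And>i. i < k \<Longrightarrow> v i = w i) \<Longrightarrow> a v = a w"
  shows "wedge k (1 + l) a (wedge 1 l (\<lambda>w. t (w 0)) b) v =
    (-1) ^ k * wedge (1 + k) l (wedge 1 k (\<lambda>w. t (w 0)) a) b v"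
proof -
  let ?P = "{\<pi>. \<pi> permutes {..<1 + k + l}}"
  let ?g = "\<lambda>\<pi>. real_of_int (sign \<pi>) * t (v (\<pi> 0)) * a (\<lambda>i. v (\<pi> (1 + i))) * b (\<lambda>i. v (\<pi> (1 + k + i)))"
  have cP: "cyc k permutes {..<1 + k + l}" by (rule cyc_permutes) simp
  have pc: "permutation (cyc k)" using cP permutation_permutes by blast
  have "sum ?g ?P = (\<Sum>\<pi>\<in>?P. ?g (\<pi> \<circ> cyc k))" by (rule sum_permutations_compose_right[OF cP])
  also have "\<dots> = (\<Sum>\<pi>\<in>?P. (-1) ^ k * (real_of_int (sign \<pi>) * a (\<lambda>i. v (\<pi> i)) *
         t (v (\<pi> (k + 0))) * b (\<lambda>i. v (\<pi> (k + (1 + i))))))"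
  proof (rule sum.cong[OF refl])
    fix \<pi> assume "\<pi> \<in> ?P"
    then have "permutation \<pi>" using permutation_permutes by blast
    moreover have "a (\<lambda>i. v ((\<pi> \<circ> cyc k) (1 + i))) = a (\<lambda>i. v (\<pi> i))"
      by (rule a) (simp add: cyc_apply)
    ultimately show "?g (\<pi> \<circ> cyc k) = (-1) ^ k * (real_of_int (sign \<pi>) * a (\<lambda>i. v (\<pi> i)) *
         t (v (\<pi> (k + 0))) * b (\<lambda>i. v (\<pi> (k + (1 + i)))))"
      by (simp add: sign_compose pc sign_cyc cyc_apply mult_ac)
  qed
  finally have "sum ?g ?P = (-1) ^ k * (\<Sum>\<pi>\<in>?P. real_of_int (sign \<pi>) * a (\<lambda>i. v (\<pi> i)) *
         t (v (\<pi> (k + 0))) * b (\<lambda>i. v (\<pi> (k + (1 + i)))))"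
    unfolding sum_distrib_left[symmetric] .
  moreover have "(-1) ^ k * (-1) ^ k = (1 :: real)" by (simp add: power_add[symmetric])
  ultimately have "(\<Sum>\<pi>\<in>?P. real_of_int (sign \<pi>) * a (\<lambda>i. v (\<pi> i)) *
         t (v (\<pi> (k + 0))) * b (\<lambda>i. v (\<pi> (k + (1 + i))))) = (-1) ^ k * sum ?g ?P"
    by (simp only: mult.assoc[symmetric] mult_1_left)
  moreover have "wedge k (1 + l) a (wedge 1 l (\<lambda>w. t (w 0)) b) v = 1 / (fact k * fact l) *
     (\<Sum>\<pi>\<in>?P. real_of_int (sign \<pi>) * a (\<lambda>i. v (\<pi> i)) *
         t (v (\<pi> (k + 0))) * b (\<lambda>i. v (\<pi> (k + (1 + i)))))"
    by (rule wedge_one_assoc_right) (rule a)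
  ultimately show ?thesis
    unfolding wedge_one_assoc_left by (simp only: mult.left_commute)
qed

lemma wedge_add_left: "wedge k l (\<lambda>w. a w + a' w) b v = wedge k l a b v + wedge k l a' b v"
  by (simp add: wedge_def algebra_simps sum.distrib add_divide_distrib)

lemma wedge_add_right: "wedge k l a (\<lambda>w. b w + b' w) v = wedge k l a b v + wedge k l a b' v"
  by (simp add: wedge_def algebra_simps sum.distrib add_divide_distrib)

lemma wedge_scale_left: "wedge k l (\<lambda>w. r * a w) b v = r * wedge k l a b v"
  by (simp add: wedge_def mult_ac sum_distrib_left)

lemma wedge_scale_right: "wedge k l a (\<lambda>w. r * b w) v = r * wedge k l a b v"
  by (simp add: wedge_def mult_ac sum_distrib_left)

lemma wedge_sum_left: "wedge k l (\<lambda>w. \<Sum>i\<in>I. a i w) b v = (\<Sum>i\<in>I. wedge k l (a i) b v)"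
  unfolding wedge_def sum_distrib_left sum_distrib_right
  by (rule sum.swap)

lemma wedge_sum_right: "wedge k l a (\<lambda>w. \<Sum>i\<in>I. b i w) v = (\<Sum>i\<in>I. wedge k l a (b i) v)"
  unfolding wedge_def sum_distrib_left sum_distrib_right
  by (rule sum.swap)

lemma wedge_zero_left: "wedge k l (\<lambda>w. 0) b v = 0"
  by (simp add: wedge_def)

lemma wedge_zero_right: "wedge k l a (\<lambda>w. 0) v = 0"
  by (simp add: wedge_def)

lemma frechet_derivative_scaleR:
  assumes "f differentiable (at x)" "g differentiable (at x)"
  shows "frechet_derivative (\<lambda>y. f y *\<^sub>R g y) (at x) h =
    f x *\<^sub>R frechet_derivative g (at x) h + frechet_derivative f (at x) h *\<^sub>R g x"
  using frechet_derivative_at[OF has_derivative_scaleR[OF assms[unfolded frechet_derivative_works]]]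
  by metis

lemmas frechet_derivative_mult = frechet_derivative_scaleR[where 'b = real, unfolded real_scaleR_def]

lemma exterior_derivative_scale:
  assumes f: "f differentiable (at x)" and \<alpha>: "\<And>v. (\<lambda>y. \<alpha> y v) differentiable (at x)"
    and alt: "alternating_map k (\<alpha> x)"
  shows "exterior_derivative k (\<lambda>y w. f y * \<alpha> y w) x =
    (\<lambda>v. f x * exterior_derivative k \<alpha> x v + wedge 1 k (\<lambda>w. frechet_derivative f (at x) (w 0)) (\<alpha> x) v)"
  unfolding exterior_derivative_def wedge_one_left[OF alt] frechet_derivative_mult[OF f \<alpha>]
  by (simp add: algebra_simps sum.distrib sum_distrib_left)

lemma lie_derivative_scale:
  assumes f: "f differentiable (at x)" and \<alpha>: "\<And>v. (\<lambda>y. \<alpha> y v) differentiable (at x)"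
  shows "lie_derivative k Y (\<lambda>y w. f y * \<alpha> y w) x =
    (\<lambda>v. f x * lie_derivative k Y \<alpha> x v + frechet_derivative f (at x) (Y x) * \<alpha> x v)"
  unfolding lie_derivative_def frechet_derivative_mult[OF f \<alpha>]
  by (simp add: algebra_simps sum_distrib_left)

lemma alternating_interior_product:
  fixes a :: "(nat \<Rightarrow> 'e::real_vector) \<Rightarrow> real"
  assumes alt: "alternating_map (Suc k) a"
  shows "alternating_map k (interior_product (Suc k) u a)"
  unfolding alternating_map_def interior_product_def
proof (intro conjI allI impI)
  fix v w :: "nat \<Rightarrow> 'e" assume "\<forall>i<k. v i = w i"
  then show "(if Suc k = 0 then 0 else a (case_nat u v)) = (if Suc k = 0 then 0 else a (case_nat u w))"
    by (simp, intro alternating_mapD(1)[OF alt]) (auto split: nat.split)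
next
  fix v :: "nat \<Rightarrow> 'e" and i assume "i < k"
  then have "linear (\<lambda>z. a ((case_nat u v)(Suc i := z)))" by (intro alternating_mapD(2)[OF alt]) auto
  moreover have "(case_nat u v)(Suc i := z) = case_nat u (v(i := z))" for z
    by (auto simp: fun_eq_iff split: nat.split)
  ultimately show "linear (\<lambda>z. if Suc k = 0 then 0 else a (case_nat u (v(i := z))))" by simp
next
  fix v :: "nat \<Rightarrow> 'e" and i j assume "i < k" "j < k" "i \<noteq> j \<and> v i = v j"
  then show "(if Suc k = 0 then 0 else a (case_nat u v)) = 0"
    by (simp, intro alternating_mapD(3)[OF alt, of "Suc i" "Suc j"]) auto
qed

lemma interior_product_linear:
  fixes a :: "(nat \<Rightarrow> 'e::real_vector) \<Rightarrow> real"
  assumes alt: "alternating_map k a"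
  shows "linear (\<lambda>u. interior_product k u a v)"
proof (cases k)
  case 0
  then show ?thesis by (simp add: interior_product_def linear_zero)
next
  case (Suc k')
  have "case_nat u v = (case_nat undefined v)(0 := u)" for u
    by (auto simp: fun_eq_iff split: nat.split)
  then have "(\<lambda>u. interior_product k u a v) = (\<lambda>u. a ((case_nat undefined v)(0 := u)))"
    unfolding interior_product_def using Suc by (metis nat.distinct(1))
  moreover have "linear (\<lambda>u. a ((case_nat undefined v)(0 := u)))"
    using Suc by (intro alternating_mapD(2)[OF alt]) simp
  ultimately show ?thesis by (simp only:)
qed

lemma lie_derivative_scale_field:
  assumes f: "f differentiable (at x)" and X: "X differentiable (at x)"
    and \<alpha>: "\<And>v. (\<lambda>y. \<alpha> y v) differentiable (at x)" and alt: "alternating_map k (\<alpha> x)"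
  shows "lie_derivative k (\<lambda>y. f y *\<^sub>R X y) \<alpha> x =
    (\<lambda>v. f x * lie_derivative k X \<alpha> x v +
      wedge 1 (k - 1) (\<lambda>w. frechet_derivative f (at x) (w 0)) (interior_product k (X x) (\<alpha> x)) v)"
proof
  fix v
  let ?D = "frechet_derivative f (at x)"
  have lin: "linear (frechet_derivative (\<lambda>y. \<alpha> y v) (at x))"
    by (rule linear_frechet_derivative[OF \<alpha>])
  have upd: "\<alpha> x (v(i := r *\<^sub>R p + s *\<^sub>R q)) = r * \<alpha> x (v(i := p)) + s * \<alpha> x (v(i := q))"
    if "i < k" for i r s p q
    using linear_add[OF alternating_mapD(2)[OF alt that, of v]]
      linear_scale[OF alternating_mapD(2)[OF alt that, of v]] by simp
  have "lie_derivative k (\<lambda>y. f y *\<^sub>R X y) \<alpha> x v =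
     f x * lie_derivative k X \<alpha> x v + (\<Sum>i<k. ?D (v i) * \<alpha> x (v(i := X x)))"
    unfolding lie_derivative_def frechet_derivative_scaleR[OF f X]
    by (simp add: linear_scale[OF lin] upd sum.distrib sum_distrib_left algebra_simps)
  also have "(\<Sum>i<k. ?D (v i) * \<alpha> x (v(i := X x))) =
      wedge 1 (k - 1) (\<lambda>w. ?D (w 0)) (interior_product k (X x) (\<alpha> x)) v"
  proof (cases k)
    case 0
    then have "interior_product k (X x) (\<alpha> x) = (\<lambda>_. 0)" by (simp add: fun_eq_iff interior_product_def)
    then show ?thesis using 0 by (simp add: wedge_zero_right)
  next
    case (Suc m)
    have "\<alpha> x (v(i := X x)) =
        (-1) ^ i * interior_product k (X x) (\<alpha> x) (\<lambda>j. v (if j < i then j else Suc j))" if i: "i < k" for i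
    proof -
      have "case_nat (X x) (\<lambda>j. v (if j < i then j else Suc j)) n = (v(i := X x)) (cyc i n)" for n
        by (cases n) (auto simp: cyc_apply)
      then have "case_nat (X x) (\<lambda>j. v (if j < i then j else Suc j)) = (\<lambda>n. (v(i := X x)) (cyc i n))"
        by (rule ext)
      then have "interior_product k (X x) (\<alpha> x) (\<lambda>j. v (if j < i then j else Suc j)) =
          \<alpha> x (\<lambda>n. (v(i := X x)) (cyc i n))"
        using Suc by (simp only: interior_product_def if_False nat.distinct)
      also have "\<dots> = (-1) ^ i * \<alpha> x (v(i := X x))"
        using alternating_map_permutes[OF alt cyc_permutes[OF i], of "v(i := X x)"] by (simp add: sign_cyc)
      finally show ?thesis by (simp add: mult.assoc[symmetric] power_mult_distrib[symmetric])
    qed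
    then have "(\<Sum>i<k. ?D (v i) * \<alpha> x (v(i := X x))) = (\<Sum>i<k. (-1) ^ i * ?D (v i) *
        interior_product k (X x) (\<alpha> x) (\<lambda>j. v (if j < i then j else Suc j)))"
      by (intro sum.cong) auto
    moreover have "{..<k} = {..m}" using Suc by auto
    moreover have "alternating_map m (interior_product k (X x) (\<alpha> x))"
      using alternating_interior_product[of m "\<alpha> x"] alt unfolding Suc by blast
    ultimately show ?thesis
      unfolding Suc diff_Suc_1 by (simp only: wedge_one_left)
  qed
  finally show "lie_derivative k (\<lambda>y. f y *\<^sub>R X y) \<alpha> x v = f x * lie_derivative k X \<alpha> x v +
      wedge 1 (k - 1) (\<lambda>w. ?D (w 0)) (interior_product k (X x) (\<alpha> x)) v" .
qed

lemma scale_left_identity: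
  fixes L X Y :: "'v::real_vector"
  shows "(f * w1) *\<^sub>R L + (f * w2) *\<^sub>R Y - (f * w3 + d * w1) *\<^sub>R X + s *\<^sub>R ((f * w4 + w5) *\<^sub>R Y + (f * w6) *\<^sub>R X) =
    w1 *\<^sub>R (f *\<^sub>R L - d *\<^sub>R X) + (f * w2 + s * w5) *\<^sub>R Y - w3 *\<^sub>R (f *\<^sub>R X) +
    s *\<^sub>R ((f * w4) *\<^sub>R Y + w6 *\<^sub>R (f *\<^sub>R X))"
  by (simp add: algebra_simps)

lemma scale_right_identity:
  fixes L X Y :: "'v::real_vector"
  assumes "s * w7 = - w8"
  shows "(f * w1) *\<^sub>R L + (f * w2 + d * w1) *\<^sub>R Y - (f * w3) *\<^sub>R X + s *\<^sub>R ((f * w4) *\<^sub>R Y + (f * w6 + w7) *\<^sub>R X) =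
    w1 *\<^sub>R (f *\<^sub>R L + d *\<^sub>R Y) + w2 *\<^sub>R (f *\<^sub>R Y) - (f * w3 + w8) *\<^sub>R X +
    s *\<^sub>R (w4 *\<^sub>R (f *\<^sub>R Y) + (f * w6) *\<^sub>R X)"
proof -
  have "w8 = - s * w7" using assms by simp
  then show ?thesis by (simp add: algebra_simps)
qed

lemma fn_decomposable_scale_left:
  assumes f: "f differentiable (at x)" and X: "X differentiable (at x)" and Y: "Y differentiable (at x)"
    and \<alpha>: "\<And>v. (\<lambda>y. \<alpha> y v) differentiable (at x)" and alt\<alpha>: "alternating_map k (\<alpha> x)"
    and \<beta>: "\<And>v. (\<lambda>y. \<beta> y v) differentiable (at x)" and alt\<beta>: "alternating_map l (\<beta> x)"
  shows "fn_decomposable k l (\<lambda>y w. f y * \<alpha> y w) X \<beta> Y x v = fn_decomposable k l \<alpha> (\<lambda>y. f y *\<^sub>R X y) \<beta> Y x v"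
proof -
  let ?t = "\<lambda>w. frechet_derivative f (at x) (w 0)"
  let ?i = "interior_product l (X x) (\<beta> x)"
  have linY: "linear (frechet_derivative Y (at x))" by (rule linear_frechet_derivative[OF Y])
  have br: "lie_bracket (\<lambda>y. f y *\<^sub>R X y) Y x = f x *\<^sub>R lie_bracket X Y x - frechet_derivative f (at x) (Y x) *\<^sub>R X x"
    unfolding lie_bracket_def frechet_derivative_scaleR[OF f X]
    by (simp add: linear_scale[OF linY] algebra_simps)
  have ip\<beta>: "interior_product l (f x *\<^sub>R X x) (\<beta> x) = (\<lambda>v. f x * ?i v)"
    using linear_scale[OF interior_product_linear[OF alt\<beta>]] by (simp add: fun_eq_iff)
  have ip\<alpha>: "interior_product k (Y x) (\<lambda>w. f x * \<alpha> x w) = (\<lambda>v. f x * interior_product k (Y x) (\<alpha> x) v)"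
    by (simp add: fun_eq_iff interior_product_def)
  have key: "wedge k l (\<alpha> x) (wedge 1 (l - 1) ?t ?i) v = (-1) ^ k * wedge (k + 1) (l - 1) (wedge 1 k ?t (\<alpha> x)) ?i v"
  proof (cases l)
    case 0
    then have "?i = (\<lambda>_. 0)" by (simp add: fun_eq_iff interior_product_def)
    moreover have "wedge 1 (l - 1) ?t (\<lambda>_. 0) = (\<lambda>_. 0)" by (simp add: fun_eq_iff wedge_zero_right)
    ultimately show ?thesis by (simp add: wedge_zero_right)
  next
    case (Suc m)
    have "wedge k (1 + m) (\<alpha> x) (wedge 1 m ?t ?i) v = (-1) ^ k * wedge (1 + k) m (wedge 1 k ?t (\<alpha> x)) ?i v"
      by (rule wedge_one_assoc) (rule alternating_mapD(1)[OF alt\<alpha>])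
    then show ?thesis by (simp only: Suc add.commute[of _ 1] plus_1_eq_Suc diff_Suc_1)
  qed
  show ?thesis
    unfolding fn_decomposable_def br ip\<beta> ip\<alpha> exterior_derivative_scale[OF f \<alpha> alt\<alpha>]
      lie_derivative_scale[OF f \<alpha>] lie_derivative_scale_field[OF f X \<beta> alt\<beta>]
      wedge_add_left wedge_add_right wedge_scale_left wedge_scale_right key
    by (rule scale_left_identity)
qed

lemma fn_decomposable_scale_right:
  assumes f: "f differentiable (at x)" and X: "X differentiable (at x)" and Y: "Y differentiable (at x)"
    and \<alpha>: "\<And>v. (\<lambda>y. \<alpha> y v) differentiable (at x)" and alt\<alpha>: "alternating_map k (\<alpha> x)"
    and \<beta>: "\<And>v. (\<lambda>y. \<beta> y v) differentiable (at x)" and alt\<beta>: "alternating_map l (\<beta> x)"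
  shows "fn_decomposable k l \<alpha> X (\<lambda>y w. f y * \<beta> y w) Y x v = fn_decomposable k l \<alpha> X \<beta> (\<lambda>y. f y *\<^sub>R Y y) x v"
proof -
  let ?t = "\<lambda>w. frechet_derivative f (at x) (w 0)"
  let ?i = "interior_product k (Y x) (\<alpha> x)"
  have linX: "linear (frechet_derivative X (at x))" by (rule linear_frechet_derivative[OF X])
  have br: "lie_bracket X (\<lambda>y. f y *\<^sub>R Y y) x = f x *\<^sub>R lie_bracket X Y x + frechet_derivative f (at x) (X x) *\<^sub>R Y x"
    unfolding lie_bracket_def frechet_derivative_scaleR[OF f Y]
    by (simp add: linear_scale[OF linX] algebra_simps)
  have ip\<alpha>: "interior_product k (f x *\<^sub>R Y x) (\<alpha> x) = (\<lambda>v. f x * ?i v)"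
    using linear_scale[OF interior_product_linear[OF alt\<alpha>]] by (simp add: fun_eq_iff)
  have ip\<beta>: "interior_product l (X x) (\<lambda>w. f x * \<beta> x w) = (\<lambda>v. f x * interior_product l (X x) (\<beta> x) v)"
    by (simp add: fun_eq_iff interior_product_def)
  have key: "(-1) ^ k * wedge (k - 1) (l + 1) ?i (wedge 1 l ?t (\<beta> x)) v = - wedge k l (wedge 1 (k - 1) ?t ?i) (\<beta> x) v"
  proof (cases k)
    case 0
    then have "?i = (\<lambda>_. 0)" by (simp add: fun_eq_iff interior_product_def)
    moreover have "wedge 1 (k - 1) ?t (\<lambda>_. 0) = (\<lambda>_. 0)" by (simp add: fun_eq_iff wedge_zero_right)
    ultimately show ?thesis by (simp add: wedge_zero_left)
  next
    case (Suc m)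
    have "alternating_map m ?i" using alternating_interior_product[of m "\<alpha> x"] alt\<alpha> Suc by simp
    then have "wedge m (1 + l) ?i (wedge 1 l ?t (\<beta> x)) v = (-1) ^ m * wedge (1 + m) l (wedge 1 m ?t ?i) (\<beta> x) v"
      by (intro wedge_one_assoc) (rule alternating_mapD(1))
    moreover have "(-1) ^ Suc m * ((-1) ^ m * r) = - r" for r :: real
      by (simp add: mult.assoc[symmetric] power_mult_distrib[symmetric])
    ultimately show ?thesis by (simp only: Suc add.commute[of _ 1] plus_1_eq_Suc diff_Suc_1)
  qed
  show ?thesis
    unfolding fn_decomposable_def br ip\<beta> ip\<alpha> exterior_derivative_scale[OF f \<beta> alt\<beta>]
      lie_derivative_scale[OF f \<beta>] lie_derivative_scale_field[OF f Y \<alpha> alt\<alpha>]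
      wedge_add_left wedge_add_right wedge_scale_left wedge_scale_right
    by (rule scale_right_identity) (rule key)
qed

lemma lie_derivative_sum_field:
  assumes X: "\<And>i. i \<in> I \<Longrightarrow> X i differentiable (at x)" and I: "finite I"
    and \<alpha>: "\<And>v. (\<lambda>y. \<alpha> y v) differentiable (at x)" and alt: "alternating_map k (\<alpha> x)"
  shows "lie_derivative k (\<lambda>y. \<Sum>i\<in>I. X i y) \<alpha> x = (\<lambda>v. \<Sum>i\<in>I. lie_derivative k (X i) \<alpha> x v)"
proof
  fix v
  have lin: "linear (frechet_derivative (\<lambda>y. \<alpha> y v) (at x))"
    by (rule linear_frechet_derivative[OF \<alpha>])
  have D: "frechet_derivative (\<lambda>y. \<Sum>i\<in>I. X i y) (at x) = (\<lambda>h. \<Sum>i\<in>I. frechet_derivative (X i) (at x) h)"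
    using X by (intro frechet_derivative_at[symmetric] has_derivative_sum) (simp add: frechet_derivative_works)
  have "(\<Sum>j<k. \<alpha> x (v(j := \<Sum>i\<in>I. frechet_derivative (X i) (at x) (v j)))) =
      (\<Sum>j<k. \<Sum>i\<in>I. \<alpha> x (v(j := frechet_derivative (X i) (at x) (v j))))"
    by (intro sum.cong refl linear_sum[OF alternating_mapD(2)[OF alt]]) simp
  also have "\<dots> = (\<Sum>i\<in>I. \<Sum>j<k. \<alpha> x (v(j := frechet_derivative (X i) (at x) (v j))))"
    by (rule sum.swap)
  finally show "lie_derivative k (\<lambda>y. \<Sum>i\<in>I. X i y) \<alpha> x v = (\<Sum>i\<in>I. lie_derivative k (X i) \<alpha> x v)"
    unfolding lie_derivative_def D by (simp add: linear_sum[OF lin] sum.distrib)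
qed

lemma lie_bracket_sum_left:
  assumes X: "\<And>i. i \<in> I \<Longrightarrow> X i differentiable (at x)" and Y: "Y differentiable (at x)"
  shows "lie_bracket (\<lambda>y. \<Sum>i\<in>I. X i y) Y x = (\<Sum>i\<in>I. lie_bracket (X i) Y x)"
proof -
  have "frechet_derivative (\<lambda>y. \<Sum>i\<in>I. X i y) (at x) = (\<lambda>h. \<Sum>i\<in>I. frechet_derivative (X i) (at x) h)"
    using X by (intro frechet_derivative_at[symmetric] has_derivative_sum) (simp add: frechet_derivative_works)
  then show ?thesis
    unfolding lie_bracket_def
    by (simp add: linear_sum[OF linear_frechet_derivative[OF Y]] sum_subtractf)
qed

lemma lie_bracket_skew: "lie_bracket X Y x = - lie_bracket Y X x"
  by (simp add: lie_bracket_def)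

lemma lie_bracket_sum_right:
  assumes "\<And>i. i \<in> I \<Longrightarrow> Y i differentiable (at x)" and "X differentiable (at x)"
  shows "lie_bracket X (\<lambda>y. \<Sum>i\<in>I. Y i y) x = (\<Sum>i\<in>I. lie_bracket X (Y i) x)"
  using lie_bracket_sum_left[OF assms]
  by (simp add: lie_bracket_skew[of X] sum_negf)

lemma interior_product_sum:
  fixes a :: "(nat \<Rightarrow> 'e::real_vector) \<Rightarrow> real"
  assumes "alternating_map k a"
  shows "interior_product k (\<Sum>i\<in>I. u i) a = (\<lambda>v. \<Sum>i\<in>I. interior_product k (u i) a v)"
  by (rule ext) (rule linear_sum[OF interior_product_linear[OF assms]])

lemma fn_decomposable_sum_left:
  assumes X: "\<And>i. i \<in> I \<Longrightarrow> X i differentiable (at x)" and I: "finite I" and Y: "Y differentiable (at x)"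
    and \<beta>: "\<And>v. (\<lambda>y. \<beta> y v) differentiable (at x)" and alt\<beta>: "alternating_map l (\<beta> x)"
  shows "fn_decomposable k l \<alpha> (\<lambda>y. \<Sum>i\<in>I. X i y) \<beta> Y x v = (\<Sum>i\<in>I. fn_decomposable k l \<alpha> (X i) \<beta> Y x v)"
proof -
  have "lie_bracket (\<lambda>y. \<Sum>i\<in>I. X i y) Y x = (\<Sum>i\<in>I. lie_bracket (X i) Y x)"
    by (rule lie_bracket_sum_left) (auto intro: X Y)
  moreover have "lie_derivative l (\<lambda>y. \<Sum>i\<in>I. X i y) \<beta> x = (\<lambda>v. \<Sum>i\<in>I. lie_derivative l (X i) \<beta> x v)"
    by (rule lie_derivative_sum_field) (auto intro: X I \<beta> alt\<beta>)
  ultimately show ?thesis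
    unfolding fn_decomposable_def interior_product_sum[OF alt\<beta>]
    by (simp add: wedge_sum_left wedge_sum_right scaleR_sum_right scaleR_sum_left sum.distrib sum_subtractf
        scaleR_right_distrib)
qed

lemma fn_decomposable_sum_right:
  assumes Y: "\<And>i. i \<in> I \<Longrightarrow> Y i differentiable (at x)" and I: "finite I" and X: "X differentiable (at x)"
    and \<alpha>: "\<And>v. (\<lambda>y. \<alpha> y v) differentiable (at x)" and alt\<alpha>: "alternating_map k (\<alpha> x)"
  shows "fn_decomposable k l \<alpha> X \<beta> (\<lambda>y. \<Sum>i\<in>I. Y i y) x v = (\<Sum>i\<in>I. fn_decomposable k l \<alpha> X \<beta> (Y i) x v)"
proof -
  have "lie_bracket X (\<lambda>y. \<Sum>i\<in>I. Y i y) x = (\<Sum>i\<in>I. lie_bracket X (Y i) x)"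
    by (rule lie_bracket_sum_right) (auto intro: X Y)
  moreover have "lie_derivative k (\<lambda>y. \<Sum>i\<in>I. Y i y) \<alpha> x = (\<lambda>v. \<Sum>i\<in>I. lie_derivative k (Y i) \<alpha> x v)"
    by (rule lie_derivative_sum_field) (auto intro: Y I \<alpha> alt\<alpha>)
  ultimately show ?thesis
    unfolding fn_decomposable_def interior_product_sum[OF alt\<alpha>]
    by (simp add: wedge_sum_left wedge_sum_right scaleR_sum_right scaleR_sum_left sum.distrib sum_subtractf
        scaleR_right_distrib)
qed

lemma smooth_on_imp_differentiable:
  assumes "smooth_on S f" "open S" "x \<in> S"
  shows "f differentiable (at x)"
proof -
  have "Ck_on (Suc 0) S f" using assms(1) unfolding smooth_on_def by blast
  then show ?thesis using assms(2,3) by (simp add: differentiable_on_eq_differentiable_at)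
qed

theorem fn_bracket_tensor:
  assumes S: "open S" "x \<in> S" and \<alpha>: "form_on S k \<alpha>" and X: "smooth_on S X"
    and \<beta>: "form_on S l \<beta>" and Y: "smooth_on S Y"
  shows "fn_bracket k l (tensor \<alpha> X) (tensor \<beta> Y) x v = fn_decomposable k l \<alpha> X \<beta> Y x v"
proof -
  note diff = smooth_on_imp_differentiable[OF _ S]
  have dX: "X differentiable (at x)" and dY: "Y differentiable (at x)" using X Y by (auto intro: diff)
  have d\<alpha>: "(\<lambda>y. \<alpha> y v) differentiable (at x)" and d\<beta>: "(\<lambda>y. \<beta> y v) differentiable (at x)" for v
    using \<alpha> \<beta> by (auto simp: form_on_def intro: diff)
  have alt\<alpha>: "alternating_map k (\<alpha> x)" and alt\<beta>: "alternating_map l (\<beta> x)"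
    using \<alpha> \<beta> S by (auto simp: form_on_def)
  have dXb: "(\<lambda>y. X y \<bullet> b) differentiable (at x)" and dYb: "(\<lambda>y. Y y \<bullet> b) differentiable (at x)" for b
    using dX dY by (auto intro: differentiable_inner)
  have dXb': "(\<lambda>y. (X y \<bullet> b) *\<^sub>R b) differentiable (at x)" and dYb': "(\<lambda>y. (Y y \<bullet> b) *\<^sub>R b) differentiable (at x)" for b
    using dXb dYb by (auto intro: differentiable_scaleR)
  have d\<beta>': "(\<lambda>y. (Y y \<bullet> c) * \<beta> y v) differentiable (at x)" for c v
    using dYb d\<beta> by (rule differentiable_mult)
  have alt\<beta>': "alternating_map l (\<lambda>w. r * \<beta> x w)" for r
    using alt\<beta> unfolding alternating_map_def by (auto intro: linear_compose_scale_right[where 'b = real, simplified] simp del: mult_eq_0_iff)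
  have "fn_bracket k l (tensor \<alpha> X) (tensor \<beta> Y) x v = (\<Sum>b\<in>Basis. \<Sum>c\<in>Basis.
      fn_decomposable k l (\<lambda>y w. (X y \<bullet> b) * \<alpha> y w) (\<lambda>_. b) (\<lambda>y w. (Y y \<bullet> c) * \<beta> y w) (\<lambda>_. c) x v)"
    unfolding fn_bracket_def tensor_def by (simp add: mult.commute)
  also have "\<dots> = (\<Sum>b\<in>Basis. \<Sum>c\<in>Basis.
      fn_decomposable k l \<alpha> (\<lambda>y. (X y \<bullet> b) *\<^sub>R b) \<beta> (\<lambda>y. (Y y \<bullet> c) *\<^sub>R c) x v)"
    using dXb dYb d\<alpha> d\<beta> d\<beta>' alt\<alpha> alt\<beta> alt\<beta>' dXb'
    by (simp add: fn_decomposable_scale_left fn_decomposable_scale_right)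
  also have "\<dots> = (\<Sum>b\<in>Basis. fn_decomposable k l \<alpha> (\<lambda>y. (X y \<bullet> b) *\<^sub>R b) \<beta> (\<lambda>y. \<Sum>c\<in>Basis. (Y y \<bullet> c) *\<^sub>R c) x v)"
    using dXb' dYb' d\<alpha> alt\<alpha> by (intro sum.cong refl fn_decomposable_sum_right[symmetric]) auto
  also have "\<dots> = (\<Sum>b\<in>Basis. fn_decomposable k l \<alpha> (\<lambda>y. (X y \<bullet> b) *\<^sub>R b) \<beta> Y x v)"
    by (simp add: euclidean_representation)
  also have "\<dots> = fn_decomposable k l \<alpha> (\<lambda>y. \<Sum>b\<in>Basis. (X y \<bullet> b) *\<^sub>R b) \<beta> Y x v"
    using dXb' dY d\<beta> alt\<beta> by (intro fn_decomposable_sum_left[symmetric]) auto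
  finally show ?thesis by (simp add: euclidean_representation)
qed

lemma frechet_derivative_lincomb:
  fixes f g :: "'a::real_normed_vector \<Rightarrow> real"
  assumes "f differentiable (at x)" "g differentiable (at x)"
  shows "frechet_derivative (\<lambda>y. r * f y + s * g y) (at x) h =
    r * frechet_derivative f (at x) h + s * frechet_derivative g (at x) h"
proof -
  have "((\<lambda>y. r * f y + s * g y) has_derivative
      (\<lambda>h. r * frechet_derivative f (at x) h + s * frechet_derivative g (at x) h)) (at x)"
    using assms unfolding frechet_derivative_works by (intro has_derivative_add has_derivative_mult_right)
  then show ?thesis by (metis frechet_derivative_at)
qed

lemma exterior_derivative_lincomb:
  assumes "\<And>v. (\<lambda>y. \<alpha> y v) differentiable (at x)" "\<And>v. (\<lambda>y. \<alpha>' y v) differentiable (at x)"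
  shows "exterior_derivative k (\<lambda>y w. r * \<alpha> y w + s * \<alpha>' y w) x =
    (\<lambda>v. r * exterior_derivative k \<alpha> x v + s * exterior_derivative k \<alpha>' x v)"
  unfolding exterior_derivative_def frechet_derivative_lincomb[OF assms]
  by (simp add: algebra_simps sum.distrib sum_distrib_left)

lemma lie_derivative_lincomb:
  assumes "\<And>v. (\<lambda>y. \<alpha> y v) differentiable (at x)" "\<And>v. (\<lambda>y. \<alpha>' y v) differentiable (at x)"
  shows "lie_derivative k X (\<lambda>y w. r * \<alpha> y w + s * \<alpha>' y w) x =
    (\<lambda>v. r * lie_derivative k X \<alpha> x v + s * lie_derivative k X \<alpha>' x v)"
  unfolding lie_derivative_def frechet_derivative_lincomb[OF assms]
  by (simp add: algebra_simps sum.distrib sum_distrib_left)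

lemma interior_product_lincomb:
  "interior_product k u (\<lambda>w. r * a w + s * b w) =
    (\<lambda>v. r * interior_product k u a v + s * interior_product k u b v)"
  by (simp add: interior_product_def fun_eq_iff)

lemma fn_decomposable_lincomb_left:
  assumes "\<And>v. (\<lambda>y. \<alpha> y v) differentiable (at x)" "\<And>v. (\<lambda>y. \<alpha>' y v) differentiable (at x)"
  shows "fn_decomposable k l (\<lambda>y w. r * \<alpha> y w + s * \<alpha>' y w) X \<beta> Y x v =
    r *\<^sub>R fn_decomposable k l \<alpha> X \<beta> Y x v + s *\<^sub>R fn_decomposable k l \<alpha>' X \<beta> Y x v"
  unfolding fn_decomposable_def exterior_derivative_lincomb[OF assms] lie_derivative_lincomb[OF assms]
    interior_product_lincomb wedge_add_left wedge_scale_left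
  by (simp add: scaleR_add_left scaleR_add_right scaleR_diff_right mult_ac)

lemma fn_decomposable_lincomb_right:
  assumes "\<And>v. (\<lambda>y. \<beta> y v) differentiable (at x)" "\<And>v. (\<lambda>y. \<beta>' y v) differentiable (at x)"
  shows "fn_decomposable k l \<alpha> X (\<lambda>y w. r * \<beta> y w + s * \<beta>' y w) Y x v =
    r *\<^sub>R fn_decomposable k l \<alpha> X \<beta> Y x v + s *\<^sub>R fn_decomposable k l \<alpha> X \<beta>' Y x v"
  unfolding fn_decomposable_def exterior_derivative_lincomb[OF assms] lie_derivative_lincomb[OF assms]
    interior_product_lincomb wedge_add_right wedge_scale_right
  by (simp add: scaleR_add_left scaleR_add_right scaleR_diff_right mult_ac)

theorem fn_bracket_bilinear:
  assumes S: "open S" "x \<in> S" and K: "form_on S k K" "form_on S k K'" and L: "form_on S l L" "form_on S l L'"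
  shows "fn_bracket k l (\<lambda>y w. r *\<^sub>R K y w + s *\<^sub>R K' y w) L x v =
      r *\<^sub>R fn_bracket k l K L x v + s *\<^sub>R fn_bracket k l K' L x v"
    and "fn_bracket k l K (\<lambda>y w. r *\<^sub>R L y w + s *\<^sub>R L' y w) x v =
      r *\<^sub>R fn_bracket k l K L x v + s *\<^sub>R fn_bracket k l K L' x v"
proof -
  have diff: "(\<lambda>y. H y w \<bullet> b) differentiable (at x)" if "form_on S m H" for m b w and H :: "'a \<Rightarrow> (nat \<Rightarrow> 'a) \<Rightarrow> 'a"
    using smooth_on_imp_differentiable[OF _ S] that by (auto simp: form_on_def intro!: differentiable_inner)
  show "fn_bracket k l (\<lambda>y w. r *\<^sub>R K y w + s *\<^sub>R K' y w) L x v =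
      r *\<^sub>R fn_bracket k l K L x v + s *\<^sub>R fn_bracket k l K' L x v"
    unfolding fn_bracket_def
    by (simp add: inner_add_left fn_decomposable_lincomb_left diff[OF K(1)] diff[OF K(2)]
        sum.distrib scaleR_sum_right)
  show "fn_bracket k l K (\<lambda>y w. r *\<^sub>R L y w + s *\<^sub>R L' y w) x v =
      r *\<^sub>R fn_bracket k l K L x v + s *\<^sub>R fn_bracket k l K L' x v"
    unfolding fn_bracket_def
    by (simp add: inner_add_left fn_decomposable_lincomb_right diff[OF L(1)] diff[OF L(2)]
        sum.distrib scaleR_sum_right)
qed

end

theory Submission
  imports Defs
begin

text \<open>
  The Froelicher--Nijenhuis bracket vanishes on forms that are parallel for a torsion-free connection,
  and the contraction of a parallel form with a parallel metric is parallel.  In a chart, with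
  components \<open>K\<^sup>b\<close> and connection forms \<open>\<theta>\<^sup>b\<^sub>a = \<Gamma>(\<cdot>, a)\<^sup>b\<close>, parallelism reads
  \<open>dK\<^sup>b = - \<Sum>\<^sub>a \<theta>\<^sup>b\<^sub>a \<and> K\<^sup>a\<close> and \<open>\<L>\<^sub>c K\<^sup>b = \<Sum>\<^sub>a \<theta>\<^sup>a\<^sub>c \<and> \<iota>\<^sub>a K\<^sup>b - \<Sum>\<^sub>a \<Gamma>(c, a)\<^sup>b K\<^sup>a\<close>; inserting this into the
  bracket, all terms cancel by the symmetry of \<open>\<Gamma>\<close>.
\<close>

section \<open>Smoothness of the musical isomorphism\<close>

text \<open>\<open>Ck_on\<close> refers to the chosen \<open>frechet_derivative\<close>. This rule
  accepts any explicit derivative formula on \<open>S\<close> instead, as supplied by the sum and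
  product rules and by the formula for the sharp map.\<close>

lemma Ck_on_SucI:
  assumes "open S" "\<And>x. x \<in> S \<Longrightarrow> (f has_derivative f' x) (at x)" "\<And>v. Ck_on n S (\<lambda>x. f' x v)"
  shows "Ck_on (Suc n) S f"
proof -
  \<comment> \<open>Since \<open>S\<close> is open, derivatives at its points see only values on
    \<open>S\<close>, so \<open>Ck_on\<close> does not depend on the map off
    \<open>S\<close>.\<close>
  have *: "Ck_on n S h" if "\<And>x. x \<in> S \<Longrightarrow> h x = h' x" "Ck_on n S h'"
    for h h' :: "'a \<Rightarrow> 'b"
    using that
  proof (induction n arbitrary: h h')
    case 0
    then show ?case by (simp cong: continuous_on_cong)
  next
    case (Suc n)
    have h': "h' differentiable (at x)" if "x \<in> S" for x
      using Suc.prems(2) that assms(1) by (simp add: differentiable_on_eq_differentiable_at)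
    have D: "(h has_derivative frechet_derivative h' (at x)) (at x)" if "x \<in> S" for x
      by (rule has_derivative_transform_within_open[OF h'[OF that, unfolded frechet_derivative_works] assms(1) that])
        (simp add: Suc.prems(1))
    then have "h differentiable_on S"
      using assms(1) by (auto simp: differentiable_on_eq_differentiable_at differentiable_def)
    moreover have "Ck_on n S (\<lambda>x. frechet_derivative h (at x) v)" for v
    proof (rule Suc.IH)
      show "frechet_derivative h (at x) v = frechet_derivative h' (at x) v" if "x \<in> S" for x
        using frechet_derivative_at[OF D[OF that]] by simp
      show "Ck_on n S (\<lambda>x. frechet_derivative h' (at x) v)" using Suc.prems(2) by simp
    qed
    ultimately show ?case by simp
  qed
  have "f differentiable_on S"
    using assms(1,2) by (auto simp: differentiable_on_eq_differentiable_at differentiable_def)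
  moreover have "Ck_on n S (\<lambda>x. frechet_derivative f (at x) v)" for v
    by (rule *[OF _ assms(3)]) (simp add: frechet_derivative_at[OF assms(2), symmetric])
  ultimately show ?thesis by simp
qed

lemma Ck_on_SucD:
  assumes "Ck_on (Suc n) S f" "open S"
  shows "x \<in> S \<Longrightarrow> (f has_derivative frechet_derivative f (at x)) (at x)"
    and "Ck_on n S (\<lambda>x. frechet_derivative f (at x) v)"
  using assms by (auto simp: differentiable_on_eq_differentiable_at frechet_derivative_works)

lemma Ck_on_Suc_imp:
  assumes "Ck_on (Suc n) S f"
  shows "Ck_on n S f"
  using assms
proof (induction n arbitrary: f)
  case 0
  then show ?case by (simp add: differentiable_imp_continuous_on)
next
  case (Suc n)
  from Suc.prems have "f differentiable_on S" "\<And>v. Ck_on (Suc n) S (\<lambda>x. frechet_derivative f (at x) v)"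
    by auto
  with Suc.IH show ?case by simp
qed

lemma Ck_on_const: "Ck_on n S (\<lambda>x. c)"
  by (induction n arbitrary: c) auto

lemma Ck_on_add:
  assumes "open S" "Ck_on n S f" "Ck_on n S g"
  shows "Ck_on n S (\<lambda>x. f x + g x)"
  using assms(2,3)
proof (induction n arbitrary: f g)
  case 0
  then show ?case by (simp add: continuous_on_add)
next
  case (Suc n)
  note f = Ck_on_SucD[OF Suc.prems(1) assms(1)] and g = Ck_on_SucD[OF Suc.prems(2) assms(1)]
  show ?case
    by (rule Ck_on_SucI[OF assms(1) has_derivative_add[OF f(1) g(1)]]) (auto intro: Suc.IH f g)
qed

lemma Ck_on_sum:
  assumes "open S" "\<And>i. i \<in> I \<Longrightarrow> Ck_on n S (f i)"
  shows "Ck_on n S (\<lambda>x. \<Sum>i\<in>I. f i x)"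
  using assms(2) by (induction I rule: infinite_finite_induct) (auto intro: Ck_on_const Ck_on_add assms(1))

lemma Ck_on_bounded_linear:
  assumes "open S" "bounded_linear T" "Ck_on n S f"
  shows "Ck_on n S (\<lambda>x. T (f x))"
  using assms(3)
proof (induction n arbitrary: f)
  case 0
  then show ?case by (simp add: bounded_linear.continuous_on[OF assms(2)])
next
  case (Suc n)
  note f = Ck_on_SucD[OF Suc.prems(1) assms(1)]
  show ?case
    by (rule Ck_on_SucI[OF assms(1) bounded_linear.has_derivative[OF assms(2) f(1)]]) (auto intro: Suc.IH f)
qed

lemma Ck_on_scaleR:
  assumes "open S" "Ck_on n S f" "Ck_on n S g"
  shows "Ck_on n S (\<lambda>x. f x *\<^sub>R g x)"
  using assms(2,3)
proof (induction n arbitrary: f g)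
  case 0
  then show ?case by (simp add: continuous_on_scaleR)
next
  case (Suc n)
  note f = Ck_on_SucD[OF Suc.prems(1) assms(1)] and g = Ck_on_SucD[OF Suc.prems(2) assms(1)]
  \<comment> \<open>Each summand of the product rule keeps one factor undifferentiated;
    \<open>Ck_on_Suc_imp\<close> lowers the order of that factor to \<open>n\<close>, as the
    induction hypothesis requires.\<close>
  show ?case
    by (rule Ck_on_SucI[OF assms(1) has_derivative_scaleR[OF f(1) g(1)]])
      (auto intro!: Suc.IH Ck_on_add f(2) g(2) Ck_on_Suc_imp[OF Suc.prems(1)] Ck_on_Suc_imp[OF Suc.prems(2)]
         assms(1))
qed

section \<open>The sharp map of a nondegenerate form and its dependence on the base point\<close>

lemma linear_eq_sum_Basis:
  fixes f :: "'e::euclidean_space \<Rightarrow> 'b::real_vector"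
  assumes "linear f"
  shows "f u = (\<Sum>b\<in>Basis. (u \<bullet> b) *\<^sub>R f b)"
proof -
  have "f u = f (\<Sum>b\<in>Basis. (u \<bullet> b) *\<^sub>R b)" by (simp add: euclidean_representation)
  then show ?thesis by (simp add: linear_sum[OF assms] linear_scale[OF assms])
qed

text \<open>\<open>sharp\<close> is a definite description, so existence and uniqueness must be
  established first. Nondegeneracy makes the map from vectors to covectors injective, and equality
  of dimensions makes it surjective.\<close>

lemma sharp_works:
  fixes h :: "'e::euclidean_space \<Rightarrow> 'e \<Rightarrow> real"
  assumes h: "bilinear h" and nd: "\<And>u. (\<And>w. h u w = 0) \<Longrightarrow> u = 0" and \<theta>: "linear \<theta>"
  shows "h (sharp h \<theta>) w = \<theta> w"
proof -
  have lin1: "linear (\<lambda>u. h u w)" and lin2: "linear (h u)" for u w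
    using h by (auto simp: bilinear_def)
  \<comment> \<open>\<open>f u\<close> represents the covector \<open>h u\<close> through the
    Euclidean inner product, which turns the map from vectors to covectors into an
    endomorphism.\<close>
  define f where "f u = (\<Sum>a\<in>Basis. h u a *\<^sub>R a)" for u
  have f: "f u \<bullet> a = h u a" if "a \<in> Basis" for u a
    using that by (simp add: f_def inner_sum_left inner_Basis if_distrib sum.delta cong: if_cong)
  have linf: "linear f"
    unfolding f_def using lin1 by (intro linear_compose_sum) (auto simp: linear_iff scaleR_left_distrib)
  have "u = 0" if "f u = 0" for u
  proof (rule nd)
    show "h u w = 0" for w
      using linear_eq_sum_Basis[OF lin2, of u w] that f
      by (metis (no_types, lifting) inner_zero_left scale_zero_right sum.neutral)
  qed
  then have "inj f" using linear_injective_0[OF linf] by blast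
  then obtain u where u: "f u = (\<Sum>a\<in>Basis. \<theta> a *\<^sub>R a)"
    using linear_injective_imp_surjective[OF linf] by (metis surjD)
  have "h u a = \<theta> a" if "a \<in> Basis" for a
  proof -
    have "h u a = (\<Sum>a\<in>Basis. \<theta> a *\<^sub>R a) \<bullet> a" using f[OF that, of u] unfolding u by simp
    then show ?thesis using that by (simp add: inner_sum_left inner_Basis if_distrib sum.delta cong: if_cong)
  qed
  then have "h u w = \<theta> w" for w
    using linear_eq_sum_Basis[OF lin2, of u w] linear_eq_sum_Basis[OF \<theta>, of w] by simp
  moreover have "v = u" if "\<forall>w. h v w = \<theta> w" for v
  proof -
    have "v - u = 0" by (rule nd) (simp add: linear_diff[OF lin1] that calculation)
    then show ?thesis by simp
  qed
  ultimately have "\<exists>!u. \<forall>w. h u w = \<theta> w" by blast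
  from theI'[OF this] show ?thesis unfolding sharp_def by blast
qed

text \<open>Where \<open>f\<close> vanishes, the product rule contains no derivative of
  \<open>g\<close>, so continuity of \<open>g\<close> is enough. In the resolvent identity below,
  \<open>g\<close> is the sharp map, whose differentiability is still to be shown.\<close>

lemma has_derivative_scaleR_vanishing:
  assumes f: "(f has_derivative f') (at x)" "f x = 0" and g: "isCont g x"
  shows "((\<lambda>y. f y *\<^sub>R g y) has_derivative (\<lambda>u. f' u *\<^sub>R g x)) (at x)"
proof -
  interpret f': bounded_linear f' using f(1) by (rule has_derivative_bounded_linear)
  obtain B where B: "\<And>u. norm (f' u) \<le> norm u * B" using f'.bounded by blast
  have lim: "((\<lambda>y. norm (f y - f' (y - x)) / norm (y - x)) \<longlongrightarrow> 0) (at x)"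
    using f(1)[unfolded has_derivative_at_within, THEN conjunct2, THEN tendsto_norm_zero] f(2)
    by (simp add: abs_mult divide_inverse mult.commute)
  have lim2: "((\<lambda>y. (norm (f y - f' (y - x)) / norm (y - x)) * norm (g y) + B * norm (g y - g x)) \<longlongrightarrow>
      0 * norm (g x) + B * norm (g x - g x)) (at x)"
    using g by (intro tendsto_intros lim) (auto simp: isCont_def)
  have "((\<lambda>y. norm (f y *\<^sub>R g y - f x *\<^sub>R g x - f' (y - x) *\<^sub>R g x) / norm (y - x)) \<longlongrightarrow> 0) (at x)"
  proof (rule Lim_null_comparison)
    show "\<forall>\<^sub>F y in at x. norm (norm (f y *\<^sub>R g y - f x *\<^sub>R g x - f' (y - x) *\<^sub>R g x) / norm (y - x)) \<le>
      (norm (f y - f' (y - x)) / norm (y - x)) * norm (g y) + B * norm (g y - g x)"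
      unfolding eventually_at_filter
    proof (intro always_eventually allI impI)
      fix y assume "y \<noteq> x"
      then have pos: "norm (y - x) > 0" by simp
      \<comment> \<open>The first summand is controlled by differentiability of \<open>f\<close> at
        \<open>x\<close>, the second by boundedness of \<open>f'\<close> and continuity of
        \<open>g\<close>.\<close>
      have "f y *\<^sub>R g y - f x *\<^sub>R g x - f' (y - x) *\<^sub>R g x = (f y - f' (y - x)) *\<^sub>R g y + f' (y - x) *\<^sub>R (g y - g x)"
        using f(2) by (simp add: algebra_simps)
      then have "norm (f y *\<^sub>R g y - f x *\<^sub>R g x - f' (y - x) *\<^sub>R g x) \<le>
          norm (f y - f' (y - x)) * norm (g y) + norm (f' (y - x)) * norm (g y - g x)"
        by (metis norm_triangle_ineq norm_scaleR real_norm_def)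
      also have "\<dots> \<le> norm (f y - f' (y - x)) * norm (g y) + (norm (y - x) * B) * norm (g y - g x)"
        by (intro add_left_mono mult_right_mono B) auto
      finally show "norm (norm (f y *\<^sub>R g y - f x *\<^sub>R g x - f' (y - x) *\<^sub>R g x) / norm (y - x)) \<le>
          (norm (f y - f' (y - x)) / norm (y - x)) * norm (g y) + B * norm (g y - g x)"
        using pos by (simp add: field_simps)
    qed
    show "((\<lambda>y. (norm (f y - f' (y - x)) / norm (y - x)) * norm (g y) + B * norm (g y - g x)) \<longlongrightarrow> 0) (at x)"
      using lim2 by simp
  qed
  moreover have "bounded_linear (\<lambda>u. f' u *\<^sub>R g x)"
    by (rule bounded_linear_scaleR_const[OF f'.bounded_linear_axioms])
  ultimately show ?thesis
    by (simp add: has_derivative_at_within divide_inverse_commute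
      tendsto_norm_zero_iff[of "\<lambda>y. (f y *\<^sub>R g y - f x *\<^sub>R g x - f' (y - x) *\<^sub>R g x) /\<^sub>R norm (y - x)", symmetric])
qed

lemma bilinear_eq_sum_Basis:
  fixes h :: "'e::euclidean_space \<Rightarrow> 'f::euclidean_space \<Rightarrow> real"
  assumes "bilinear h"
  shows "h u w = (\<Sum>a\<in>Basis. \<Sum>b\<in>Basis. (u \<bullet> a) * (w \<bullet> b) * h a b)"
proof -
  have "linear (\<lambda>u. h u w)" and "linear (h u)" for u w
    using assms by (auto simp: bilinear_def)
  then have "h u w = (\<Sum>a\<in>Basis. (u \<bullet> a) *\<^sub>R h a w)" "h a w = (\<Sum>b\<in>Basis. (w \<bullet> b) *\<^sub>R h a b)" for a
    by (auto intro: linear_eq_sum_Basis simp del: real_scaleR_def)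
  then show ?thesis by (simp add: sum_distrib_left mult_ac)
qed

text \<open>A bootstrap without an explicit inverse matrix: the resolvent identity gives continuity,
  then a derivative. This derivative is a polynomial in the sharps themselves and the derivatives of
  \<open>h\<close>, so the order of regularity can be raised by induction.\<close>

lemma smooth_on_sharp:
  fixes h :: "'e::euclidean_space \<Rightarrow> 'e \<Rightarrow> 'e \<Rightarrow> real"
  assumes S: "open S" and bil: "\<And>x. x \<in> S \<Longrightarrow> bilinear (h x)"
    and nd: "\<And>x u. x \<in> S \<Longrightarrow> (\<And>w. h x u w = 0) \<Longrightarrow> u = 0"
    and smooth: "\<And>u v. smooth_on S (\<lambda>x. h x u v)"
  shows "smooth_on S (\<lambda>x. sharp (h x) (\<lambda>w. w \<bullet> b))"
proof -
  define s where "s = (\<lambda>b x. sharp (h x) (\<lambda>w. w \<bullet> b))"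
  let ?B = "Basis :: 'e set"
  have s: "h x (s b x) w = w \<bullet> b" if "x \<in> S" for x b w
    unfolding s_def by (rule sharp_works[OF bil[OF that] nd[OF that]])
      (auto intro: bounded_linear.linear bounded_linear_inner_left)
  have diff: "(\<lambda>y. h y u w) differentiable (at x)" if "x \<in> S" for x u w
    by (rule smooth_on_imp_differentiable[OF smooth S that])
  \<comment> \<open>The resolvent identity, in coordinates so that only scalar functions of the base point occur.\<close>
  have resolvent: "s b y = s b x - (\<Sum>a\<in>?B. \<Sum>e\<in>?B. ((h y e a - h x e a) * (s b y \<bullet> e)) *\<^sub>R s a x)"
    if x: "x \<in> S" and y: "y \<in> S" for x y b
  proof -
    have lin: "linear (\<lambda>u. h x u w)" for w using bil[OF x] by (simp add: bilinear_def)
    define r where "r = s b y - (s b x - (\<Sum>a\<in>?B. \<Sum>e\<in>?B. ((h y e a - h x e a) * (s b y \<bullet> e)) *\<^sub>R s a x))"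
    \<comment> \<open>Pairing with \<open>h x\<close> turns each \<open>s a x\<close> into the
      coordinate \<open>w \<bullet> a\<close>, so the double sum collapses to
      \<open>h y (s b y) w - h x (s b y) w\<close>; the rest cancels because
      \<open>h x (s b x) w\<close> and \<open>h y (s b y) w\<close> both equal
      \<open>w \<bullet> b\<close>.\<close>
    have "r = 0"
    proof (rule nd[OF x])
      fix w
      have "(\<Sum>a\<in>?B. \<Sum>e\<in>?B. (h y e a - h x e a) * (s b y \<bullet> e) * (w \<bullet> a)) = h y (s b y) w - h x (s b y) w"
        unfolding bilinear_eq_sum_Basis[OF bil[OF x], of "s b y" w] bilinear_eq_sum_Basis[OF bil[OF y], of "s b y" w]
        by (subst sum.swap) (simp add: algebra_simps sum_subtractf)
      then show "h x r w = 0"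
        unfolding r_def by (simp add: linear_diff[OF lin] linear_sum[OF lin] linear_scale[OF lin] s[OF x] s[OF y])
    qed
    then show ?thesis by (simp add: r_def)
  qed
  have cont: "isCont (s b) x" if x: "x \<in> S" for b x
  proof -
    define q where "q y = (\<Sum>a\<in>?B. \<Sum>e\<in>?B. \<bar>h y e a - h x e a\<bar> * norm (s a x))" for y
    have q0: "q \<midarrow>x\<rightarrow> 0"
    proof -
      have "isCont q x" unfolding q_def
        by (intro continuous_intros differentiable_imp_continuous_within diff x)
      then show ?thesis by (simp add: isCont_def q_def)
    qed
    \<comment> \<open>The unknown \<open>s b y\<close> stands on both sides. Where
      \<open>q y < 1/2\<close>, the right side can be absorbed, so \<open>s b y\<close> has at most
      twice the norm of \<open>s b x\<close>, and the estimate then tends to 0 with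
      \<open>q\<close>.\<close>
    have est: "norm (s b y - s b x) \<le> q y * norm (s b y)" if "y \<in> S" for y
    proof -
      have "norm (s b y - s b x) = norm (\<Sum>a\<in>?B. \<Sum>e\<in>?B. ((h y e a - h x e a) * (s b y \<bullet> e)) *\<^sub>R s a x)"
        by (subst resolvent[OF x that]) simp
      moreover have "\<dots> \<le> (\<Sum>a\<in>?B. \<Sum>e\<in>?B. \<bar>h y e a - h x e a\<bar> * norm (s a x) * norm (s b y))"
        by (intro sum_norm_le) (auto simp: abs_mult mult_ac intro!: mult_left_mono mult_right_mono Basis_le_norm)
      ultimately show ?thesis by (simp only: q_def sum_distrib_right)
    qed
    have ev: "\<forall>\<^sub>F y in at x. q y < 1/2" by (rule order_tendstoD[OF q0]) simp
    have evS: "\<forall>\<^sub>F y in at x. y \<in> S" using S x by (simp add: eventually_at_in_open')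
    have "((\<lambda>y. s b y - s b x) \<longlongrightarrow> 0) (at x)"
    proof (rule Lim_null_comparison)
      show "((\<lambda>y. q y * (2 * norm (s b x))) \<longlongrightarrow> 0) (at x)"
        using tendsto_mult_left_zero[OF q0] .
      show "\<forall>\<^sub>F y in at x. norm (s b y - s b x) \<le> q y * (2 * norm (s b x))"
        using ev evS
      proof eventually_elim
        fix y assume y: "q y < 1/2" "y \<in> S"
        have q_nonneg: "0 \<le> q y" unfolding q_def by (intro sum_nonneg) auto
        have "norm (s b y) \<le> norm (s b x) + norm (s b y - s b x)" by (metis add.commute diff_add_cancel norm_triangle_ineq)
        also have "\<dots> \<le> norm (s b x) + q y * norm (s b y)" using est[OF y(2)] by simp
        also have "\<dots> \<le> norm (s b x) + 1/2 * norm (s b y)" using y by (intro add_left_mono mult_right_mono) auto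
        finally have "norm (s b y) \<le> 2 * norm (s b x)" by simp
        then show "norm (s b y - s b x) \<le> q y * (2 * norm (s b x))"
          using est[OF y(2)] q_nonneg by (meson mult_left_mono order_trans)
      qed
    qed
    then show ?thesis by (simp add: isCont_def LIM_zero_iff)
  qed
  \<comment> \<open>This is the derivative of an inverse, minus the inverse times the derivative
    times the inverse, written in coordinates.\<close>
  let ?D = "\<lambda>b x u. - (\<Sum>a\<in>?B. \<Sum>e\<in>?B. (frechet_derivative (\<lambda>y. h y e a) (at x) u * (s b x \<bullet> e)) *\<^sub>R s a x)"
  have deriv: "(s b has_derivative ?D b x) (at x)" if x: "x \<in> S" for b x
  proof -
    have "((\<lambda>y. (h y e a - h x e a) *\<^sub>R ((s b y \<bullet> e) *\<^sub>R s a x)) has_derivative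
        (\<lambda>u. frechet_derivative (\<lambda>y. h y e a) (at x) u *\<^sub>R ((s b x \<bullet> e) *\<^sub>R s a x))) (at x)" for a e
      using diff[OF x, unfolded frechet_derivative_works, of e a] cont[OF x, of b]
      by (intro has_derivative_scaleR_vanishing continuous_intros) (auto intro!: derivative_eq_intros)
    then have "((\<lambda>y. s b x - (\<Sum>a\<in>?B. \<Sum>e\<in>?B. (h y e a - h x e a) *\<^sub>R ((s b y \<bullet> e) *\<^sub>R s a x))) has_derivative
        (\<lambda>u. 0 - (\<Sum>a\<in>?B. \<Sum>e\<in>?B. frechet_derivative (\<lambda>y. h y e a) (at x) u *\<^sub>R ((s b x \<bullet> e) *\<^sub>R s a x)))) (at x)"
      by (intro has_derivative_diff has_derivative_const has_derivative_sum)
    then have "((\<lambda>y. s b x - (\<Sum>a\<in>?B. \<Sum>e\<in>?B. (h y e a - h x e a) *\<^sub>R ((s b y \<bullet> e) *\<^sub>R s a x))) has_derivative ?D b x) (at x)"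
      by simp
    then show ?thesis
      by (rule has_derivative_transform_within_open[OF _ S x]) (use resolvent[OF x] in simp)
  qed
  \<comment> \<open>\<open>?D b\<close> involves \<open>s b\<close> and all the \<open>s a\<close>
    without derivatives, hence the induction over every basis vector at once.\<close>
  have "Ck_on n S (s b)" for n b
  proof (induction n arbitrary: b)
    case 0
    show ?case using cont by (simp add: continuous_at_imp_continuous_on)
  next
    case (Suc n)
    have h: "Ck_on n S (\<lambda>x. frechet_derivative (\<lambda>y. h y e a) (at x) u)" for e a u
      using smooth[of e a] Ck_on_SucD(2)[OF _ S] unfolding smooth_on_def by blast
    have si: "Ck_on n S (\<lambda>x. s b x \<bullet> e)" for b e
      by (rule Ck_on_bounded_linear[OF S bounded_linear_inner_left Suc.IH])
    show ?case
    proof (rule Ck_on_SucI[OF S deriv])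
      fix u
      have "Ck_on n S (\<lambda>x. (frechet_derivative (\<lambda>y. h y e a) (at x) u * (s b x \<bullet> e)) *\<^sub>R s a x)" for a e
        using Ck_on_scaleR[OF S Ck_on_scaleR[OF S h si] Suc.IH] by simp
      then show "Ck_on n S (\<lambda>x. ?D b x u)"
        by (intro Ck_on_bounded_linear[OF S bounded_linear_minus[OF bounded_linear_ident]] Ck_on_sum[OF S])
    qed
  qed
  then show ?thesis by (simp add: smooth_on_def s_def)
qed

section \<open>The bracket of parallel forms\<close>

text \<open>Moving slot \<open>i\<close> to the front is the cycle \<open>cyc i\<close>, whose sign
  is \<open>(-1) ^ i\<close>. This puts an inserted argument where \<open>interior_product\<close>
  expects it.\<close>

lemma alternating_map_upd:
  fixes a :: "(nat \<Rightarrow> 'e::real_vector) \<Rightarrow> real"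
  assumes a: "alternating_map k a" and i: "i < k"
  shows "a (v(i := z)) = (-1) ^ i * a (case_nat z (\<lambda>j. v (if j < i then j else Suc j)))"
proof -
  have "case_nat z (\<lambda>j. v (if j < i then j else Suc j)) n = (v(i := z)) (cyc i n)" for n
    by (cases n) (auto simp: cyc_apply)
  then have "case_nat z (\<lambda>j. v (if j < i then j else Suc j)) = (\<lambda>n. (v(i := z)) (cyc i n))"
    by (rule ext)
  then show ?thesis
    using alternating_map_permutes[OF a cyc_permutes[OF i], of "v(i := z)"]
    by (simp add: sign_cyc mult.assoc[symmetric] power_mult_distrib[symmetric])
qed

text \<open>Expanding \<open>T (v i)\<close> in the basis and moving it to the front gives the
  expansion of a wedge with a one-form. It converts Christoffel terms acting on the arguments into
  the wedge products of which the bracket is made.\<close>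

lemma sum_derivation_eq_wedge:
  fixes a :: "(nat \<Rightarrow> 'e::euclidean_space) \<Rightarrow> real"
  assumes a: "alternating_map k a"
  shows "(\<Sum>i<k. a (v(i := T (v i)))) =
    (\<Sum>b\<in>Basis. wedge 1 (k - 1) (\<lambda>w. T (w 0) \<bullet> b) (interior_product k b a) v)"
proof (cases k)
  case 0
  then have "interior_product k b a = (\<lambda>_. 0)" for b by (simp add: fun_eq_iff interior_product_def)
  then show ?thesis using 0 by (simp add: wedge_zero_right)
next
  case (Suc m)
  have alt: "alternating_map m (interior_product k b a)" for b
    using alternating_interior_product[of m a b] a unfolding Suc by blast
  have "a (v(i := T (v i))) = (\<Sum>b\<in>Basis. (-1) ^ i * (T (v i) \<bullet> b) *
      interior_product k b a (\<lambda>j. v (if j < i then j else Suc j)))" if i: "i < k" for i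
  proof -
    have lin: "linear (\<lambda>u. a (v(i := u)))" by (rule alternating_mapD(2)[OF a i])
    have "a (v(i := T (v i))) = a (v(i := \<Sum>b\<in>Basis. (T (v i) \<bullet> b) *\<^sub>R b))"
      by (simp add: euclidean_representation)
    also have "\<dots> = (\<Sum>b\<in>Basis. (T (v i) \<bullet> b) * a (v(i := b)))"
      by (simp add: linear_sum[OF lin] linear_scale[OF lin])
    finally show ?thesis
      using Suc by (simp add: alternating_map_upd[OF a i] interior_product_def mult_ac)
  qed
  then have "(\<Sum>i<k. a (v(i := T (v i)))) = (\<Sum>i\<le>m. \<Sum>b\<in>Basis. (-1) ^ i * (T (v i) \<bullet> b) *
      interior_product k b a (\<lambda>j. v (if j < i then j else Suc j)))"
    using Suc by (simp add: lessThan_Suc_atMost)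
  also have "\<dots> = (\<Sum>b\<in>Basis. \<Sum>i\<le>m. (-1) ^ i * (T (v i) \<bullet> b) *
      interior_product k b a (\<lambda>j. v (if j < i then j else Suc j)))"
    by (rule sum.swap)
  also have "\<dots> = (\<Sum>b\<in>Basis. wedge 1 m (\<lambda>w. T (w 0) \<bullet> b) (interior_product k b a) v)"
    by (intro sum.cong refl wedge_one_left[OF alt, symmetric])
  finally show ?thesis using Suc by simp
qed

text \<open>The summand for \<open>(i, j)\<close> with \<open>j < i\<close> cancels the one for \<open>(j, i - 1)\<close>.\<close>

lemma sum_alternation_symmetric:
  fixes a :: "(nat \<Rightarrow> 'e::real_vector) \<Rightarrow> real"
  assumes a: "alternating_map m a" and sym: "\<And>p q. B p q = B q p"
  shows "(\<Sum>i\<le>m. (-1) ^ i * (\<Sum>j<m. a ((\<lambda>n. v (if n < i then n else Suc n))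
      (j := B (v i) (v (if j < i then j else Suc j)))))) = 0"
proof -
  \<comment> \<open>\<open>s i\<close> enumerates the indices other than \<open>i\<close>;
    \<open>G\<close> moves the value of \<open>B\<close> to the front, so that paired summands can
    be compared argument by argument.\<close>
  define s where "s i n = (if n < i then n else Suc n)" for i n :: nat
  define G where "G = (\<lambda>(i, j). (-1) ^ (i + j) * a (case_nat (B (v i) (v (s i j))) (\<lambda>n. v (s i (s j n)))))"
  let ?L = "{(i, j). j < i \<and> i \<le> m}" and ?R = "{(i, j). i \<le> j \<and> j < m}"
  have "(\<Sum>i\<le>m. (-1) ^ i * (\<Sum>j<m. a ((\<lambda>n. v (s i n)) (j := B (v i) (v (s i j)))))) =
      (\<Sum>i\<le>m. \<Sum>j<m. G (i, j))"
    unfolding sum_distrib_left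
    by (intro sum.cong refl) (simp add: alternating_map_upd[OF a] G_def s_def power_add mult.assoc)
  also have "\<dots> = sum G ({..m} \<times> {..<m})" by (simp add: sum.cartesian_product)
  also have "{..m} \<times> {..<m} = ?L \<union> ?R" by auto
  also have "sum G (?L \<union> ?R) = sum G ?L + sum G ?R"
    by (rule sum.union_disjoint)
      (auto intro: finite_subset[of _ "{..m} \<times> {..m}"])
  also have "sum G ?L = (\<Sum>x\<in>?R. - G x)"
  proof (rule sum.reindex_bij_witness[of _ "\<lambda>(i, j). (Suc j, i)" "\<lambda>(i, j). (j, i - 1)"])
    fix x assume "x \<in> ?L"
    then obtain i j where x: "x = (Suc i, j)" "j \<le> i" "Suc i \<le> m" by (auto elim: less_natE)
    \<comment> \<open>Deleting the two indices in either order leaves the same remaining arguments.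
      The values of \<open>B\<close> agree by symmetry, and the exponents of -1 differ by
      one.\<close>
    have "s (Suc i) (s j n) = s j (s i n)" for n using x(2) by (auto simp: s_def)
    moreover have "s (Suc i) j = j" "s j i = Suc i" using x(2) by (auto simp: s_def)
    ultimately show "- G (case x of (i, j) \<Rightarrow> (j, i - 1)) = G x"
      by (simp add: x(1) G_def sym[of "v j"] add.commute)
  qed auto
  finally have "(\<Sum>i\<le>m. (-1) ^ i * (\<Sum>j<m. a ((\<lambda>n. v (s i n)) (j := B (v i) (v (s i j)))))) = 0"
    by (simp only: sum_negf add.left_inverse)
  then show ?thesis unfolding s_def .
qed

text \<open>Associativity, with the sign \<open>(-1) ^ k\<close> for carrying a one-form past a form
  of degree \<open>k\<close>. For \<open>l = 0\<close> the interior product is zero, which makes the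
  truncated \<open>l - 1\<close> harmless.\<close>

lemma wedge_one_move_left:
  fixes a b :: "(nat \<Rightarrow> 'e::real_vector) \<Rightarrow> real"
  assumes a: "alternating_map k a"
  shows "wedge k l a (wedge 1 (l - 1) (\<lambda>w. t (w 0)) (interior_product l X b)) v =
    (-1) ^ k * wedge (k + 1) (l - 1) (wedge 1 k (\<lambda>w. t (w 0)) a) (interior_product l X b) v"
proof (cases l)
  case 0
  then have "interior_product l X b = (\<lambda>_. 0)" by (simp add: fun_eq_iff interior_product_def)
  moreover have "wedge 1 (l - 1) (\<lambda>w. t (w 0)) (\<lambda>_. 0) = (\<lambda>_ :: nat \<Rightarrow> 'e. 0)"
    by (simp add: fun_eq_iff wedge_zero_right)
  ultimately show ?thesis by (simp add: wedge_zero_right)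
next
  case (Suc m)
  have "wedge k (1 + m) a (wedge 1 m (\<lambda>w. t (w 0)) (interior_product l X b)) v =
      (-1) ^ k * wedge (1 + k) m (wedge 1 k (\<lambda>w. t (w 0)) a) (interior_product l X b) v"
    by (rule wedge_one_assoc) (rule alternating_mapD(1)[OF a])
  then show ?thesis by (simp only: Suc add.commute[of _ 1] plus_1_eq_Suc diff_Suc_1)
qed

text \<open>Here the one-form passes a form of degree \<open>k - 1\<close>; together with the
  prefactor \<open>(-1) ^ k\<close> of the bracket this leaves a single minus sign. For
  \<open>k = 0\<close> both sides vanish.\<close>

lemma wedge_one_move_right:
  fixes a b :: "(nat \<Rightarrow> 'e::real_vector) \<Rightarrow> real"
  assumes a: "alternating_map k a"
  shows "(-1) ^ k * wedge (k - 1) (l + 1) (interior_product k X a) (wedge 1 l (\<lambda>w. t (w 0)) b) v =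
    - wedge k l (wedge 1 (k - 1) (\<lambda>w. t (w 0)) (interior_product k X a)) b v"
proof (cases k)
  case 0
  then have "interior_product k X a = (\<lambda>_. 0)" by (simp add: fun_eq_iff interior_product_def)
  moreover have "wedge 1 (k - 1) (\<lambda>w. t (w 0)) (\<lambda>_. 0) = (\<lambda>_ :: nat \<Rightarrow> 'e. 0)"
    by (simp add: fun_eq_iff wedge_zero_right)
  ultimately show ?thesis by (simp add: wedge_zero_left)
next
  case (Suc m)
  have "alternating_map m (interior_product k X a)"
    using alternating_interior_product[of m a] a Suc by simp
  then have "wedge m (1 + l) (interior_product k X a) (wedge 1 l (\<lambda>w. t (w 0)) b) v =
      (-1) ^ m * wedge (1 + m) l (wedge 1 m (\<lambda>w. t (w 0)) (interior_product k X a)) b v"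
    by (intro wedge_one_assoc) (rule alternating_mapD(1))
  moreover have "(-1) ^ Suc m * ((-1) ^ m * r) = - r" for r :: real
    by (simp add: mult.assoc[symmetric] power_mult_distrib[symmetric])
  ultimately show ?thesis by (simp only: Suc add.commute[of _ 1] plus_1_eq_Suc diff_Suc_1)
qed

lemma alternating_map_inner:
  fixes a :: "(nat \<Rightarrow> 'e::real_vector) \<Rightarrow> 'b::real_inner"
  assumes "alternating_map k a"
  shows "alternating_map k (\<lambda>v. a v \<bullet> b)"
  unfolding alternating_map_def
proof (intro conjI allI impI)
  show "a v \<bullet> b = a w \<bullet> b" if "\<forall>i<k. v i = w i" for v w
    using alternating_mapD(1)[OF assms, of v w] that by simp
  show "linear (\<lambda>u. a (v(i := u)) \<bullet> b)" if "i < k" for v i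
    using alternating_mapD(2)[OF assms that, of v] by (simp add: linear_iff inner_add_left)
  show "a v \<bullet> b = 0" if "i < k" "j < k" "i \<noteq> j \<and> v i = v j" for v i j
    using alternating_mapD(3)[OF assms, of i j v] that by simp
qed

section \<open>Differential calculus of the components of a parallel form, and the vanishing
  bracket\<close>

text \<open>\<open>G\<close> is the value at \<open>x\<close> of the Christoffel symbols; the derivative is \<open>\<nabla>K = 0\<close> evaluated on
  constant vector fields.\<close>

definition parallel_tangent_form_at ::
    "'e::euclidean_space \<Rightarrow> ('e \<Rightarrow> 'e \<Rightarrow> 'e) \<Rightarrow> nat \<Rightarrow> ('e \<Rightarrow> (nat \<Rightarrow> 'e) \<Rightarrow> 'e) \<Rightarrow> bool" where
  "parallel_tangent_form_at x G k K \<longleftrightarrow> alternating_map k (K x) \<and>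
     (\<forall>v. ((\<lambda>y. K y v) has_derivative (\<lambda>u. (\<Sum>i<k. K x (v(i := G u (v i)))) - G u (K x v))) (at x))"

lemma parallel_component_derivative:
  assumes "parallel_tangent_form_at x G k K"
  shows "frechet_derivative (\<lambda>y. K y v \<bullet> b) (at x) u =
    (\<Sum>i<k. K x (v(i := G u (v i))) \<bullet> b) - G u (K x v) \<bullet> b"
proof -
  have "((\<lambda>y. K y v) has_derivative (\<lambda>u. (\<Sum>i<k. K x (v(i := G u (v i)))) - G u (K x v))) (at x)"
    using assms by (simp add: parallel_tangent_form_at_def)
  from frechet_derivative_at[OF has_derivative_inner_left[OF this, of b], symmetric]
  show ?thesis by (simp add: inner_diff_left inner_sum_left)
qed

lemma bilinear_inner_eq_sum:
  fixes G :: "'e::euclidean_space \<Rightarrow> 'e \<Rightarrow> 'e"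
  assumes "bilinear G"
  shows "G u w \<bullet> b = (\<Sum>a\<in>Basis. (G u a \<bullet> b) * (w \<bullet> a))"
proof -
  have lin: "linear (G u)" using assms by (simp add: bilinear_def)
  show ?thesis
    by (subst linear_eq_sum_Basis[OF lin]) (simp add: inner_sum_left mult.commute)
qed

text \<open>Of the two kinds of Christoffel terms in the derivative, those acting on the arguments
  disappear under alternation because \<open>G\<close> is symmetric. The term acting on the value
  remains and is the wedge with the connection forms.\<close>

lemma exterior_derivative_parallel_component:
  fixes K :: "'e::euclidean_space \<Rightarrow> (nat \<Rightarrow> 'e) \<Rightarrow> 'e"
  assumes K: "parallel_tangent_form_at x G k K" and G: "bilinear G" "\<And>u w. G u w = G w u"
  shows "exterior_derivative k (\<lambda>y w. K y w \<bullet> b) x =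
    (\<lambda>v. - (\<Sum>a\<in>Basis. wedge 1 k (\<lambda>w. G (w 0) a \<bullet> b) (\<lambda>w. K x w \<bullet> a) v))"
proof
  fix v :: "nat \<Rightarrow> 'e"
  have alt: "alternating_map k (\<lambda>w. K x w \<bullet> a)" for a
    using K by (intro alternating_map_inner) (simp add: parallel_tangent_form_at_def)
  let ?s = "\<lambda>i n. v (if n < i then n else Suc n)"
  have "exterior_derivative k (\<lambda>y w. K y w \<bullet> b) x v =
      (\<Sum>i\<le>k. (-1) ^ i * (\<Sum>j<k. K x ((?s i)(j := G (v i) (?s i j))) \<bullet> b)) -
      (\<Sum>i\<le>k. (-1) ^ i * (G (v i) (K x (?s i)) \<bullet> b))"
    unfolding exterior_derivative_def parallel_component_derivative[OF K]
    by (simp add: right_diff_distrib sum_subtractf)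
  also have "(\<Sum>i\<le>k. (-1) ^ i * (\<Sum>j<k. K x ((?s i)(j := G (v i) (?s i j))) \<bullet> b)) = 0"
    by (rule sum_alternation_symmetric[OF alt G(2)])
  also have "(\<Sum>i\<le>k. (-1) ^ i * (G (v i) (K x (?s i)) \<bullet> b)) =
      (\<Sum>a\<in>Basis. \<Sum>i\<le>k. (-1) ^ i * (G (v i) a \<bullet> b) * (K x (?s i) \<bullet> a))"
    by (subst sum.swap) (simp add: bilinear_inner_eq_sum[OF G(1), of _ "K x _"] sum_distrib_left mult.assoc)
  also have "\<dots> = (\<Sum>a\<in>Basis. wedge 1 k (\<lambda>w. G (w 0) a \<bullet> b) (\<lambda>w. K x w \<bullet> a) v)"
    by (intro sum.cong refl wedge_one_left[OF alt, of "\<lambda>u. G u _ \<bullet> b", symmetric])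
  finally show "exterior_derivative k (\<lambda>y w. K y w \<bullet> b) x v =
      - (\<Sum>a\<in>Basis. wedge 1 k (\<lambda>w. G (w 0) a \<bullet> b) (\<lambda>w. K x w \<bullet> a) v)" by simp
qed

text \<open>Along a constant field the Lie derivative is a directional derivative, which parallelism
  expresses through \<open>G\<close>. Symmetry rewrites \<open>G c (v i)\<close> as
  \<open>G (v i) c\<close>, a derivation applied to the arguments, so
  \<open>sum_derivation_eq_wedge\<close> applies.\<close>

lemma lie_derivative_parallel_component:
  fixes K :: "'e::euclidean_space \<Rightarrow> (nat \<Rightarrow> 'e) \<Rightarrow> 'e"
  assumes K: "parallel_tangent_form_at x G k K" and G: "bilinear G" "\<And>u w. G u w = G w u"
  shows "lie_derivative k (\<lambda>_. c) (\<lambda>y w. K y w \<bullet> b) x =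
    (\<lambda>v. (\<Sum>a\<in>Basis. wedge 1 (k - 1) (\<lambda>w. G (w 0) c \<bullet> a) (interior_product k a (\<lambda>w. K x w \<bullet> b)) v)
       + (\<Sum>a\<in>Basis. - (G c a \<bullet> b) * (K x v \<bullet> a)))"
proof
  fix v :: "nat \<Rightarrow> 'e"
  have alt: "alternating_map k (\<lambda>w. K x w \<bullet> b)"
    using K by (intro alternating_map_inner) (simp add: parallel_tangent_form_at_def)
  \<comment> \<open>The constant field \<open>c\<close> has zero derivative, so the correction terms
    of \<open>lie_derivative\<close> insert the vector 0.\<close>
  have zero: "K x (v(i := 0)) \<bullet> b = 0" if "i < k" for i
    using linear_0[OF alternating_mapD(2)[OF alt that, of v]] .
  have "lie_derivative k (\<lambda>_. c) (\<lambda>y w. K y w \<bullet> b) x v =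
      (\<Sum>i<k. K x (v(i := G (v i) c)) \<bullet> b) - G c (K x v) \<bullet> b"
    unfolding lie_derivative_def parallel_component_derivative[OF K] by (simp add: zero G(2)[of c])
  then show "lie_derivative k (\<lambda>_. c) (\<lambda>y w. K y w \<bullet> b) x v =
      (\<Sum>a\<in>Basis. wedge 1 (k - 1) (\<lambda>w. G (w 0) c \<bullet> a) (interior_product k a (\<lambda>w. K x w \<bullet> b)) v)
       + (\<Sum>a\<in>Basis. - (G c a \<bullet> b) * (K x v \<bullet> a))"
    using sum_derivation_eq_wedge[OF alt, of v "\<lambda>u. G u c"]
    by (simp add: bilinear_inner_eq_sum[OF G(1), of _ "K x _"] sum_negf)
qed

lemma wedge_uminus_left: "wedge k l (\<lambda>w. - a w) b v = - wedge k l a b v"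
  using wedge_scale_left[of k l "-1" a b v] by simp

lemma wedge_uminus_right: "wedge k l a (\<lambda>w. - b w) v = - wedge k l a b v"
  using wedge_scale_right[of k l a "-1" b v] by simp

lemma sum_rotate: "(\<Sum>a\<in>A. \<Sum>b\<in>B. \<Sum>c\<in>C. f a b c) = (\<Sum>b\<in>B. \<Sum>c\<in>C. \<Sum>a\<in>A. f a b c)"
  by (subst sum.swap) (intro sum.cong refl sum.swap)

text \<open>Only renaming of summation indices: the \<open>Q\<close> terms cancel on exchanging
  \<open>a\<close> and \<open>b\<close>, the \<open>S\<close> terms on exchanging \<open>a\<close>
  and \<open>c\<close>, and the \<open>R\<close> terms after a cyclic renaming and the symmetry of
  \<open>H\<close>.\<close>

lemma parallel_bracket_cancellation:
  fixes B :: "'e::real_vector set" and Q S H :: "'e \<Rightarrow> 'e \<Rightarrow> 'e \<Rightarrow> real"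
  assumes H: "\<And>a b c. H a b c = H b a c"
  shows "(\<Sum>b\<in>B. \<Sum>c\<in>B. (\<Sum>a\<in>B. Q a b c - H b a c * R b a) *\<^sub>R c
      - (\<Sum>a\<in>B. S a b c - H c a b * R a c) *\<^sub>R b
      - (\<Sum>a\<in>B. Q b a c) *\<^sub>R c + (\<Sum>a\<in>B. S c b a) *\<^sub>R b) = 0"
proof -
  have Q: "(\<Sum>b\<in>B. \<Sum>c\<in>B. \<Sum>a\<in>B. Q a b c *\<^sub>R c) = (\<Sum>b\<in>B. \<Sum>c\<in>B. \<Sum>a\<in>B. Q b a c *\<^sub>R c)"
  proof -
    have "(\<Sum>b\<in>B. \<Sum>c\<in>B. \<Sum>a\<in>B. Q a b c *\<^sub>R c) = (\<Sum>a\<in>B. \<Sum>b\<in>B. \<Sum>c\<in>B. Q a b c *\<^sub>R c)"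
      by (rule sum_rotate[symmetric])
    also have "\<dots> = (\<Sum>b\<in>B. \<Sum>c\<in>B. \<Sum>a\<in>B. Q b a c *\<^sub>R c)"
      by (intro sum.cong refl sum.swap)
    finally show ?thesis .
  qed
  have S: "(\<Sum>b\<in>B. \<Sum>c\<in>B. \<Sum>a\<in>B. S a b c *\<^sub>R b) = (\<Sum>b\<in>B. \<Sum>c\<in>B. \<Sum>a\<in>B. S c b a *\<^sub>R b)"
    by (intro sum.cong refl sum.swap)
  have "(\<Sum>b\<in>B. \<Sum>c\<in>B. \<Sum>a\<in>B. (H c a b * R a c) *\<^sub>R b) = (\<Sum>c\<in>B. \<Sum>a\<in>B. \<Sum>b\<in>B. (H c a b * R a c) *\<^sub>R b)"
    by (rule sum_rotate)
  also have "\<dots> = (\<Sum>a\<in>B. \<Sum>c\<in>B. \<Sum>b\<in>B. (H a c b * R a c) *\<^sub>R b)"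
    by (subst sum.swap) (simp add: H)
  also have "\<dots> = (\<Sum>b\<in>B. \<Sum>c\<in>B. \<Sum>a\<in>B. (H b a c * R b a) *\<^sub>R c)"
    by (intro sum.cong refl sum.swap)
  finally have R: "(\<Sum>b\<in>B. \<Sum>c\<in>B. \<Sum>a\<in>B. (H c a b * R a c) *\<^sub>R b) =
      (\<Sum>b\<in>B. \<Sum>c\<in>B. \<Sum>a\<in>B. (H b a c * R b a) *\<^sub>R c)" .
  show ?thesis
    by (simp add: scaleR_sum_left sum_subtractf sum.distrib scaleR_left_diff_distrib Q S R)
qed

theorem fn_bracket_parallel:
  assumes K: "parallel_tangent_form_at x G k K" and L: "parallel_tangent_form_at x G l L"
    and G: "bilinear G" "\<And>u w. G u w = G w u"
  shows "fn_bracket k l K L x v = 0"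
proof -
  have altK: "alternating_map k (\<lambda>w. K x w \<bullet> b)" for b
    using K by (intro alternating_map_inner) (simp add: parallel_tangent_form_at_def)
  \<comment> \<open>\<open>Q\<close> arises from the Lie derivative of \<open>L\<close> and from the
    exterior derivative of \<open>K\<close>, \<open>S\<close> from the Lie derivative of
    \<open>K\<close> and from the exterior derivative of \<open>L\<close>. \<open>R\<close>,
    weighted by the Christoffel coefficients \<open>H\<close>, collects the Lie derivative terms
    that act on values.\<close>
  define Q where "Q a b c = (-1) ^ k * wedge (k + 1) (l - 1) (wedge 1 k (\<lambda>w. G (w 0) b \<bullet> a) (\<lambda>w. K x w \<bullet> b))
      (interior_product l a (\<lambda>w. L x w \<bullet> c)) v" for a b c
  define S where "S a b c = wedge k l (wedge 1 (k - 1) (\<lambda>w. G (w 0) c \<bullet> a) (interior_product k a (\<lambda>w. K x w \<bullet> b)))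
      (\<lambda>w. L x w \<bullet> c) v" for a b c
  define R where "R a b = wedge k l (\<lambda>w. K x w \<bullet> a) (\<lambda>w. L x w \<bullet> b) v" for a b
  define H where "H a b c = G a b \<bullet> c" for a b c
  have dec: "fn_decomposable k l (\<lambda>y w. K y w \<bullet> b) (\<lambda>_. b) (\<lambda>y w. L y w \<bullet> c) (\<lambda>_. c) x v =
      (\<Sum>a\<in>Basis. Q a b c - H b a c * R b a) *\<^sub>R c - (\<Sum>a\<in>Basis. S a b c - H c a b * R a c) *\<^sub>R b
      - (\<Sum>a\<in>Basis. Q b a c) *\<^sub>R c + (\<Sum>a\<in>Basis. S c b a) *\<^sub>R b" (is "?l = _") for b c
  proof -
    have "wedge k l (\<lambda>w. K x w \<bullet> b) (wedge 1 (l - 1) (\<lambda>w. G (w 0) b \<bullet> a)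
        (interior_product l a (\<lambda>w. L x w \<bullet> c))) v = Q a b c" for a
      unfolding Q_def by (rule wedge_one_move_left[OF altK, where t = "\<lambda>u. G u b \<bullet> a"])
    then have "wedge k l (\<lambda>w. K x w \<bullet> b) (lie_derivative l (\<lambda>_. b) (\<lambda>y w. L y w \<bullet> c) x) v =
        (\<Sum>a\<in>Basis. Q a b c - H b a c * R b a)"
      unfolding lie_derivative_parallel_component[OF L G] wedge_add_right wedge_sum_right wedge_scale_right
      by (simp add: H_def R_def sum_subtractf sum_negf)
    moreover have "wedge k l (lie_derivative k (\<lambda>_. c) (\<lambda>y w. K y w \<bullet> b) x) (\<lambda>w. L x w \<bullet> c) v =
        (\<Sum>a\<in>Basis. S a b c - H c a b * R a c)"
      unfolding lie_derivative_parallel_component[OF K G] wedge_add_left wedge_sum_left wedge_scale_left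
      by (simp add: S_def H_def R_def sum_subtractf sum_negf)
    moreover have "(-1) ^ k * wedge (k + 1) (l - 1) (exterior_derivative k (\<lambda>y w. K y w \<bullet> b) x)
        (interior_product l b (\<lambda>w. L x w \<bullet> c)) v = - (\<Sum>a\<in>Basis. Q b a c)"
      unfolding exterior_derivative_parallel_component[OF K G] wedge_uminus_left wedge_sum_left
      by (simp add: Q_def sum_distrib_left)
    moreover have "(-1) ^ k * wedge (k - 1) (l + 1) (interior_product k c (\<lambda>w. K x w \<bullet> b))
        (wedge 1 l (\<lambda>w. G (w 0) a \<bullet> c) (\<lambda>w. L x w \<bullet> a)) v = - S c b a" for a
      unfolding S_def by (rule wedge_one_move_right[OF altK, where t = "\<lambda>u. G u a \<bullet> c"])
    then have "(-1) ^ k * wedge (k - 1) (l + 1) (interior_product k c (\<lambda>w. K x w \<bullet> b))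
        (exterior_derivative l (\<lambda>y w. L y w \<bullet> c) x) v = (\<Sum>a\<in>Basis. S c b a)"
      unfolding exterior_derivative_parallel_component[OF L G] wedge_uminus_right wedge_sum_right
      by (simp add: sum_distrib_left sum_negf)
    moreover have "lie_bracket (\<lambda>_. b) (\<lambda>_. c) x = 0" by (simp add: lie_bracket_def)
    ultimately show ?thesis
      unfolding fn_decomposable_def by (simp add: scaleR_add_right)
  qed
  show ?thesis
    unfolding fn_bracket_def dec
    by (rule parallel_bracket_cancellation) (simp add: H_def G(2))
qed

section \<open>The contraction of a parallel form\<close>

lemma alternating_map_scaleR:
  fixes a :: "(nat \<Rightarrow> 'e::real_vector) \<Rightarrow> real"
  assumes "alternating_map k a"
  shows "alternating_map k (\<lambda>v. a v *\<^sub>R c)"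
  unfolding alternating_map_def
proof (intro conjI allI impI)
  show "a v *\<^sub>R c = a w *\<^sub>R c" if "\<forall>i<k. v i = w i" for v w
    using alternating_mapD(1)[OF assms, of v w] that by simp
  show "linear (\<lambda>u. a (v(i := u)) *\<^sub>R c)" if "i < k" for v i
    using alternating_mapD(2)[OF assms that, of v] by (simp add: linear_iff scaleR_left_distrib)
  show "a v *\<^sub>R c = 0" if "i < k" "j < k" "i \<noteq> j \<and> v i = v j" for v i j
    using alternating_mapD(3)[OF assms, of i j v] that by simp
qed

lemma alternating_map_sum:
  fixes a :: "'i \<Rightarrow> (nat \<Rightarrow> 'e::real_vector) \<Rightarrow> 'b::real_vector"
  assumes "\<And>i. i \<in> I \<Longrightarrow> alternating_map k (a i)"
  shows "alternating_map k (\<lambda>v. \<Sum>i\<in>I. a i v)"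
  unfolding alternating_map_def
proof (intro conjI allI impI)
  show "(\<Sum>i\<in>I. a i v) = (\<Sum>i\<in>I. a i w)" if "\<forall>i<k. v i = w i" for v w
    by (rule sum.cong[OF refl], rule alternating_mapD(1)[OF assms]) (use that in auto)
  show "linear (\<lambda>u. \<Sum>i\<in>I. a i (v(j := u)))" if "j < k" for v j
    by (rule linear_compose_sum) (use alternating_mapD(2)[OF assms that] in blast)
  show "(\<Sum>i\<in>I. a i v) = 0" if "i < k" "j < k" "i \<noteq> j \<and> v i = v j" for v i j
    by (rule sum.neutral) (use alternating_mapD(3)[OF assms, of _ i j v] that in blast)
qed

text \<open>Pairing with the metric undoes each sharp and leaves a coordinate of \<open>w\<close>;
  linearity in the first slot of \<alpha> reassembles them. This frame-free description is the
  source of both naturality and parallelism of the contraction.\<close>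

lemma metric_contraction:
  fixes h :: "'e::euclidean_space \<Rightarrow> 'e \<Rightarrow> 'e \<Rightarrow> real"
  assumes h: "bilinear (h x)" and nd: "\<And>u. (\<And>w. h x u w = 0) \<Longrightarrow> u = 0"
    and \<alpha>: "alternating_map (Suc m) (\<alpha> x)"
  shows "h x (contraction h (Suc m) \<alpha> x v) w = \<alpha> x (case_nat w v)"
proof -
  have lin: "linear (\<lambda>u. h x u w)" using h by (simp add: bilinear_def)
  have sharp: "h x (sharp (h x) (\<lambda>w. w \<bullet> b)) w = w \<bullet> b" for b
    by (rule sharp_works[OF h nd]) (auto intro: bounded_linear.linear bounded_linear_inner_left)
  have "interior_product (Suc m) w (\<alpha> x) v = (\<Sum>b\<in>Basis. (w \<bullet> b) *\<^sub>R interior_product (Suc m) b (\<alpha> x) v)"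
    by (rule linear_eq_sum_Basis[OF interior_product_linear[OF \<alpha>]])
  moreover have "interior_product (Suc m) w (\<alpha> x) v = \<alpha> x (case_nat w v)"
    by (simp add: interior_product_def)
  ultimately show ?thesis
    unfolding contraction_def by (simp add: linear_sum[OF lin] linear_scale[OF lin] sharp mult.commute)
qed

lemma form_on_contraction:
  fixes h :: "'e::euclidean_space \<Rightarrow> 'e \<Rightarrow> 'e \<Rightarrow> real"
  assumes S: "open S" and h: "\<And>x. x \<in> S \<Longrightarrow> bilinear (h x)"
    and nd: "\<And>x u. x \<in> S \<Longrightarrow> (\<And>w. h x u w = 0) \<Longrightarrow> u = 0"
    and smooth: "\<And>u v. smooth_on S (\<lambda>x. h x u v)" and \<alpha>: "form_on S (Suc m) \<alpha>"
  shows "form_on S m (contraction h (Suc m) \<alpha>)"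
  unfolding form_on_def
proof (intro conjI ballI allI)
  fix x assume "x \<in> S"
  then have alt: "alternating_map (Suc m) (\<alpha> x)" using \<alpha> by (simp add: form_on_def)
  show "alternating_map m (contraction h (Suc m) \<alpha> x)"
    unfolding contraction_def
    by (intro alternating_map_sum alternating_map_scaleR alternating_interior_product alt)
next
  fix v
  have s: "smooth_on S (\<lambda>x. sharp (h x) (\<lambda>w. w \<bullet> b))" for b
    using S h nd smooth by (rule smooth_on_sharp)
  show "smooth_on S (\<lambda>x. contraction h (Suc m) \<alpha> x v)"
    unfolding smooth_on_def contraction_def interior_product_def if_not_P[OF nat.distinct(2)]
  proof (intro allI Ck_on_sum Ck_on_scaleR S)
    show "Ck_on n S (\<lambda>x. sharp (h x) (\<lambda>w. w \<bullet> b))" for n b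
      using s by (simp add: smooth_on_def)
    show "Ck_on n S (\<lambda>x. \<alpha> x (case_nat b v))" for n b
      using \<alpha> by (simp add: form_on_def smooth_on_def)
  qed
qed

text \<open>By nondegeneracy it suffices to compare pairings with arbitrary vectors. The isometry
  \<open>T\<close> is injective, hence surjective, so every test vector is some \<open>T w\<close>,
  and \<open>metric_contraction\<close> reduces both sides to the invariance of the form.\<close>

lemma contraction_natural:
  fixes h h' :: "'e::euclidean_space \<Rightarrow> 'e \<Rightarrow> 'e \<Rightarrow> real"
  assumes h: "bilinear (h x)" and pos: "\<And>u. u \<noteq> 0 \<Longrightarrow> h x u u > 0" and \<alpha>: "alternating_map (Suc m) (\<alpha> x)"
    and h': "bilinear (h' y)" and pos': "\<And>u. u \<noteq> 0 \<Longrightarrow> h' y u u > 0" and \<beta>: "alternating_map (Suc m) (\<beta> y)"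
    and T: "linear T" and hT: "\<And>u w. h' y (T u) (T w) = h x u w"
    and \<alpha>T: "\<And>v. \<beta> y (\<lambda>i. T (v i)) = \<alpha> x v"
  shows "contraction h' (Suc m) \<beta> y (\<lambda>i. T (v i)) = T (contraction h (Suc m) \<alpha> x v)"
proof -
  have nd: "u = 0" if "\<And>w. h x u w = 0" for u using that[of u] pos[of u] by fastforce
  have nd': "u = 0" if "\<And>w. h' y u w = 0" for u using that[of u] pos'[of u] by fastforce
  have "u = 0" if "T u = 0" for u
  proof (rule nd)
    show "h x u w = 0" for w using hT[of u w] bilinear_lzero[OF h', of "T w"] that by simp
  qed
  then have "surj T"
    using linear_injective_0[OF T] linear_injective_imp_surjective[OF T] by blast
  let ?K = "contraction h (Suc m) \<alpha> x v" and ?K' = "contraction h' (Suc m) \<beta> y (\<lambda>i. T (v i))"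
  have "?K' - T ?K = 0"
  proof (rule nd')
    fix w'
    obtain w where w: "w' = T w" using \<open>surj T\<close> by blast
    have "h' y ?K' w' = \<beta> y (case_nat w' (\<lambda>i. T (v i)))"
      by (rule metric_contraction[where h = h' and x = y and \<alpha> = \<beta>, OF h' nd' \<beta>])
    also have "case_nat w' (\<lambda>i. T (v i)) = (\<lambda>i. T (case_nat w v i))"
      by (auto simp: w fun_eq_iff split: nat.split)
    also have "\<beta> y \<dots> = h x ?K w"
      unfolding \<alpha>T by (rule metric_contraction[where h = h and x = x and \<alpha> = \<alpha>, OF h nd \<alpha>, symmetric])
    finally show "h' y (?K' - T ?K) w' = 0" by (simp add: w bilinear_lsub[OF h'] hT)
  qed
  then show ?thesis by simp
qed

text \<open>Differentiate \<open>h (K v) w = \<alpha> (w, v)\<close>: the left side is governed by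
  metric compatibility, the right side by parallelism of \<alpha>. Nondegeneracy then isolates the
  derivative of \<open>K\<close>.\<close>

lemma parallel_contraction:
  fixes h :: "'e::euclidean_space \<Rightarrow> 'e \<Rightarrow> 'e \<Rightarrow> real"
  assumes S: "open S" "x \<in> S" and h: "\<And>x. x \<in> S \<Longrightarrow> bilinear (h x)"
    and nd: "\<And>x u. x \<in> S \<Longrightarrow> (\<And>w. h x u w = 0) \<Longrightarrow> u = 0"
    and smooth: "\<And>u v. smooth_on S (\<lambda>x. h x u v)" and \<alpha>: "form_on S (Suc m) \<alpha>"
    and G: "bilinear (G x)"
    and compat: "\<And>u v w. frechet_derivative (\<lambda>y. h y v w) (at x) u = h x (G x u v) w + h x v (G x u w)"
    and parallel: "\<And>u v. covariant_derivative_form G (Suc m) \<alpha> x u v = 0"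
  shows "parallel_tangent_form_at x (G x) m (contraction h (Suc m) \<alpha>)"
proof -
  define K where "K = contraction h (Suc m) \<alpha>"
  have K: "form_on S m K" unfolding K_def
    using S(1) h nd smooth \<alpha> by (rule form_on_contraction[where h = h and S = S])
  have hK: "h y (K y v) w = \<alpha> y (case_nat w v)" if "y \<in> S" for y v w
    unfolding K_def
  proof (rule metric_contraction[where h = h and x = y and \<alpha> = \<alpha>])
    show "bilinear (h y)" by (rule h[OF that])
    show "alternating_map (Suc m) (\<alpha> y)" using \<alpha> that by (simp add: form_on_def)
  qed (rule nd[OF that])
  have lin: "linear (\<lambda>u. h x u w)" for w using h[OF S(2)] by (simp add: bilinear_def)
  have linG: "linear (G x u)" for u using G by (simp add: bilinear_def)
  have "((\<lambda>y. K y v) has_derivative (\<lambda>u. (\<Sum>i<m. K x (v(i := G x u (v i)))) - G x u (K x v))) (at x)" for v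
  proof -
    define F where "F = frechet_derivative (\<lambda>y. K y v) (at x)"
    have F: "((\<lambda>y. K y v) has_derivative F) (at x)"
      using smooth_on_imp_differentiable[of S "\<lambda>y. K y v", OF _ S] K
      unfolding F_def frechet_derivative_works[symmetric] by (simp add: form_on_def)
    have Dh: "((\<lambda>y. h y a w) has_derivative (\<lambda>u. h x (G x u a) w + h x a (G x u w))) (at x)" for a w
      using smooth_on_imp_differentiable[OF smooth S, of a w]
      unfolding frechet_derivative_works compat .
    have "F u - ((\<Sum>i<m. K x (v(i := G x u (v i)))) - G x u (K x v)) = 0" for u
    proof (rule nd[OF S(2)])
      fix w
      \<comment> \<open>Both \<open>h y\<close> and its first argument vary with \<open>y\<close>;
        expanding that argument in coordinates reduces the derivative to the product rule for real
        functions.\<close>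
      have "((\<lambda>y. \<Sum>a\<in>Basis. (K y v \<bullet> a) * h y a w) has_derivative
          (\<lambda>u. \<Sum>a\<in>Basis. (K x v \<bullet> a) * (h x (G x u a) w + h x a (G x u w)) + (F u \<bullet> a) * h x a w)) (at x)"
        by (intro has_derivative_sum has_derivative_mult has_derivative_inner_left F Dh)
      then have "((\<lambda>y. \<alpha> y (case_nat w v)) has_derivative
          (\<lambda>u. \<Sum>a\<in>Basis. (K x v \<bullet> a) * (h x (G x u a) w + h x a (G x u w)) + (F u \<bullet> a) * h x a w)) (at x)"
      proof (rule has_derivative_transform_within_open[OF _ S])
        fix y assume y: "y \<in> S"
        have "linear (\<lambda>u. h y u w)" using h[OF y] by (simp add: bilinear_def)
        from linear_eq_sum_Basis[OF this, of "K y v"]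
        show "(\<Sum>a\<in>Basis. (K y v \<bullet> a) * h y a w) = \<alpha> y (case_nat w v)" by (simp add: hK[OF y])
      qed
      from frechet_derivative_at[OF this, symmetric]
      have "frechet_derivative (\<lambda>y. \<alpha> y (case_nat w v)) (at x) u =
          (\<Sum>a\<in>Basis. (K x v \<bullet> a) * h x (G x u a) w) + (\<Sum>a\<in>Basis. (K x v \<bullet> a) * h x a (G x u w))
          + (\<Sum>a\<in>Basis. (F u \<bullet> a) * h x a w)"
        by (simp add: sum.distrib distrib_left)
      also have "(\<Sum>a\<in>Basis. (K x v \<bullet> a) * h x (G x u a) w) = h x (G x u (K x v)) w"
        using linear_eq_sum_Basis[OF linear_compose[OF linG[of u] lin[of w]], of "K x v", unfolded o_def] by simp
      also have "(\<Sum>a\<in>Basis. (K x v \<bullet> a) * h x a (G x u w)) = h x (K x v) (G x u w)"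
        using linear_eq_sum_Basis[OF lin[of "G x u w"], of "K x v"] by simp
      also have "(\<Sum>a\<in>Basis. (F u \<bullet> a) * h x a w) = h x (F u) w"
        using linear_eq_sum_Basis[OF lin[of w], of "F u"] by simp
      finally have 1: "frechet_derivative (\<lambda>y. \<alpha> y (case_nat w v)) (at x) u =
          h x (G x u (K x v)) w + h x (K x v) (G x u w) + h x (F u) w" .
      \<comment> \<open>Slot 0 of the parallelism of \<alpha> yields
        \<open>h x (K x v) (G x u w)\<close>, which cancels against the same term in
        \<open>1\<close>; the other slots give the Christoffel terms on the arguments of
        \<open>K\<close>.\<close>
      have "(case_nat w v)(0 := G x u w) = case_nat (G x u w) v"
        and "(case_nat w v)(Suc i := z) = case_nat w (v(i := z))" for i z
        by (auto simp: fun_eq_iff split: nat.split)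
      then have "frechet_derivative (\<lambda>y. \<alpha> y (case_nat w v)) (at x) u =
          h x (K x v) (G x u w) + (\<Sum>i<m. h x (K x (v(i := G x u (v i)))) w)"
        using parallel[of u "case_nat w v"] hK[OF S(2)]
        unfolding covariant_derivative_form_def sum.lessThan_Suc_shift by simp
      with 1 show "h x (F u - ((\<Sum>i<m. K x (v(i := G x u (v i)))) - G x u (K x v))) w = 0"
        by (simp add: linear_diff[OF lin] linear_sum[OF lin])
    qed
    then have "F = (\<lambda>u. (\<Sum>i<m. K x (v(i := G x u (v i)))) - G x u (K x v))" by (simp add: fun_eq_iff)
    with F show ?thesis by simp
  qed
  then show ?thesis
    using K S(2) unfolding parallel_tangent_form_at_def K_def[symmetric] form_on_def by blast
qed

section \<open>Transition maps between charts and the passage to the manifold\<close>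

lemma open_overlap:
  assumes "is_chart c" "is_chart d"
  shows "open (overlap c d)"
proof -
  obtain \<psi> where \<psi>: "homeomorphism (fst c) (chart_image c) (snd c) \<psi>"
    using assms(1) by (auto simp: is_chart_def)
  have "openin (top_of_set (fst c)) (fst c \<inter> fst d)"
    using assms(2) by (auto simp: is_chart_def intro: openin_open_Int)
  from homeomorphism_imp_open_map[OF \<psi> this] show ?thesis
    using assms(1) unfolding overlap_def is_chart_def by (auto intro: openin_open_trans)
qed

text \<open>Injectivity of the coordinate map on its domain lets \<open>inv_into\<close> recover the
  very point that lies in both charts.\<close>

lemma transition_in_chart_image:
  assumes "is_chart c" "x \<in> overlap c d"
  shows "x \<in> chart_image c" "transition c d x \<in> chart_image d"
proof -
  obtain p where p: "p \<in> fst c" "p \<in> fst d" "x = snd c p" using assms(2) by (auto simp: overlap_def)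
  obtain \<psi> where "homeomorphism (fst c) (chart_image c) (snd c) \<psi>"
    using assms(1) by (auto simp: is_chart_def)
  then have "inj_on (snd c) (fst c)" by (metis homeomorphism_def inj_on_inverseI)
  then have "transition c d x = snd d p" using p by (simp add: transition_def)
  then show "x \<in> chart_image c" "transition c d x \<in> chart_image d" using p by (auto simp: chart_image_def)
qed

text \<open>\<open>frechet_derivative\<close> is a choice that is known to be linear only where a
  derivative exists; openness of the overlap turns smoothness of the transition into
  differentiability at \<open>x\<close>.\<close>

lemma linear_dtransition:
  assumes "smooth_atlas A" "c \<in> A" "d \<in> A" "x \<in> overlap c d"
  shows "linear (dtransition c d x)"
  unfolding dtransition_def
proof (rule linear_frechet_derivative[OF smooth_on_imp_differentiable])
  have "is_chart c" "is_chart d" using assms by (auto simp: smooth_atlas_def)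
  then show "open (overlap c d)" by (rule open_overlap)
  show "smooth_on (overlap c d) (transition c d)" using assms by (auto simp: smooth_atlas_def)
qed (rule assms(4))

lemma smooth_on_const: "smooth_on S (\<lambda>x. c)"
  by (simp add: smooth_on_def Ck_on_const)

theorem proposition2p3:
  fixes A :: "('a::{t2_space,second_countable_topology}, 'e::euclidean_space) chart set"
    and g :: "('a, 'e) chart \<Rightarrow> 'e \<Rightarrow> 'e \<Rightarrow> 'e \<Rightarrow> real"
    and \<Gamma> :: "('a, 'e) chart \<Rightarrow> 'e \<Rightarrow> 'e \<Rightarrow> 'e \<Rightarrow> 'e"
    and \<Psi> :: "('a, 'e) chart \<Rightarrow> 'e \<Rightarrow> (nat \<Rightarrow> 'e) \<Rightarrow> real"
    and k :: nat
  assumes "smooth_atlas A"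
    and "riemannian_metric A g"
    and "levi_civita_connection A g \<Gamma>"
    and "k \<ge> 1"
    and "\<Psi> \<in> forms A (2 * k)"
    and "parallel_form A \<Gamma> (2 * k) \<Psi>"
  shows "maurer_cartan A (2 * k - 1) (\<lambda>c. contraction (g c) (2 * k) (\<Psi> c))"
proof -
  \<comment> \<open>As \<open>k \<ge> 1\<close>, the truncated subtraction is exact and
    \<open>2 * k = Suc m\<close>, the form of degree required by the contraction lemmas.\<close>
  define m where "m = 2 * k - 1"
  have k: "2 * k = Suc m" using assms(4) by (simp add: m_def)
  note defs = assms(5,6)[unfolded k]
  let ?K = "\<lambda>c. contraction (g c) (Suc m) (\<Psi> c)"
  have S: "open (chart_image c)" if "c \<in> A" for c
    using assms(1) that by (auto simp: smooth_atlas_def is_chart_def)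
  have bil: "bilinear (g c x)" and pos: "u \<noteq> 0 \<Longrightarrow> g c x u u > 0" if "c \<in> A" "x \<in> chart_image c" for c x u
    using assms(2) that by (auto simp: riemannian_metric_def)
  have nd: "u = 0" if "c \<in> A" "x \<in> chart_image c" "\<And>w. g c x u w = 0" for c x u
    using pos[OF that(1,2), of u] that(3)[of u] by fastforce
  have smooth: "smooth_on (chart_image c) (\<lambda>x. g c x u v)" if "c \<in> A" for c u v
    using assms(2) that by (simp add: riemannian_metric_def)
  have \<Psi>: "form_on (chart_image c) (Suc m) (\<Psi> c)" if "c \<in> A" for c
    using defs(1) that by (simp add: forms_def)
  have "?K \<in> tangent_forms A m"
    unfolding tangent_forms_def mem_Collect_eq
  proof (intro conjI ballI allI)
    fix c assume c: "c \<in> A"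
    show "form_on (chart_image c) m (?K c)"
      using S[OF c] bil[OF c] nd[OF c] smooth[OF c] \<Psi>[OF c] by (rule form_on_contraction)
  next
    fix c d x v assume c: "c \<in> A" and d: "d \<in> A" and x: "x \<in> overlap c d"
    have "is_chart c" using assms(1) c by (simp add: smooth_atlas_def)
    note x' = transition_in_chart_image[OF this x]
    show "?K d (transition c d x) (\<lambda>i. dtransition c d x (v i)) = dtransition c d x (?K c x v)"
    proof (rule contraction_natural[where T = "dtransition c d x" and h = "g c" and h' = "g d"])
      show "bilinear (g c x)" "bilinear (g d (transition c d x))" using bil c d x' by auto
      show "g c x u u > 0" "g d (transition c d x) u u > 0" if "u \<noteq> 0" for u
        using pos c d x' that by auto
      show "linear (dtransition c d x)" by (rule linear_dtransition[OF assms(1) c d x])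
      show "alternating_map (Suc m) (\<Psi> c x)" "alternating_map (Suc m) (\<Psi> d (transition c d x))"
        using \<Psi>[OF c] \<Psi>[OF d] x' by (auto simp: form_on_def)
      show "g d (transition c d x) (dtransition c d x u) (dtransition c d x w) = g c x u w" for u w
        using assms(2) c d x by (auto simp: riemannian_metric_def)
      show "\<Psi> d (transition c d x) (\<lambda>i. dtransition c d x (v i)) = \<Psi> c x v" for v
        using defs(1) c d x by (auto simp: forms_def)
    qed
  qed
  moreover have "fn_bracket m m (?K c) (?K c) x v = 0" if c: "c \<in> A" and x: "x \<in> chart_image c" for c x v
  proof -
    have G: "bilinear (\<Gamma> c x)"
      using assms(3) c x by (auto simp: levi_civita_connection_def is_connection_def)
    \<comment> \<open>On constant fields the Lie bracket and the derivative terms vanish, so absence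
      of torsion becomes symmetry of the Christoffel symbols.\<close>
    have sym: "\<Gamma> c x u w = \<Gamma> c x w u" for u w
    proof -
      have "covariant_derivative (\<Gamma> c) (\<lambda>_. u) (\<lambda>_. w) x - covariant_derivative (\<Gamma> c) (\<lambda>_. w) (\<lambda>_. u) x =
          lie_bracket (\<lambda>_. u) (\<lambda>_. w) x"
        using assms(3) c x smooth_on_const unfolding levi_civita_connection_def by blast
      then show ?thesis by (simp add: covariant_derivative_def lie_bracket_def)
    qed
    \<comment> \<open>Metric compatibility on constant fields, whose covariant derivatives are
      purely Christoffel terms.\<close>
    have compat: "frechet_derivative (\<lambda>y. g c y v w) (at x) u = g c x (\<Gamma> c x u v) w + g c x v (\<Gamma> c x u w)"
      for u v w
    proof -
      have "\<And>X Y Z. smooth_on (chart_image c) X \<Longrightarrow> smooth_on (chart_image c) Y \<Longrightarrow> smooth_on (chart_image c) Z \<Longrightarrow>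
          frechet_derivative (\<lambda>y. g c y (Y y) (Z y)) (at x) (X x) =
             g c x (covariant_derivative (\<Gamma> c) X Y x) (Z x) +
             g c x (Y x) (covariant_derivative (\<Gamma> c) X Z x)"
        using assms(3) c x unfolding levi_civita_connection_def by blast
      from this[of "\<lambda>_. u" "\<lambda>_. v" "\<lambda>_. w", OF smooth_on_const smooth_on_const smooth_on_const]
      show ?thesis by (simp add: covariant_derivative_def)
    qed
    have "parallel_tangent_form_at x (\<Gamma> c x) m (?K c)"
      using S[OF c] x bil[OF c] nd[OF c] smooth[OF c] \<Psi>[OF c] G compat
    proof (rule parallel_contraction)
      show "covariant_derivative_form (\<Gamma> c) (Suc m) (\<Psi> c) x u v = 0" for u v
        using defs(2) c x by (simp add: parallel_form_def)
    qed
    from fn_bracket_parallel[OF this this G sym] show ?thesis .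
  qed
  ultimately show ?thesis
    unfolding maurer_cartan_def k m_def[symmetric] by simp
qed

end
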